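(* Let $(A,B)$ be a pair of real random variables with $A\ge 0$, $A\not\equiv 1$. Let $\kappa>0$ and assume: (1) $\theta:=\mathbf{E}A^\kappa<1$ (and $\theta>0$); (2) $F_\kappa\in\mathcal{S}_{loc}$; (3) with $\Delta=(0,1]$, $\sup_{y>x}F_\kappa(y+\Delta)=O(F_\kappa(x+\Delta))$ for $x$ large enough, i.e. there are constants $K,x_0$ with $\sup_{y>x}F_\kappa(y+\Delta)\le K F_\kappa(x+\Delta)$ for all $x\ge x_0$; (4) the law of $\log A$ conditioned on $A\ne0$ is nonarithmetic; (5) $\mathbf{E}|B|^\nu<\infty$ for some $\nu>\kappa$. Let $X$ be the solution of $X\stackrel{\mathcal D}{=}AX\vee B$, where on the right-hand side $(A,B)$ and $X$ are independent, and put $g(x)=F_\kappa(x+1)-F_\kappa(x)$. Then $$\lim_{x\to\infty}g(\log x)^{-1}x^\kappa\,\mathbf{P}\{X>x\}=\frac{\theta}{(1-\theta)^2\kappa}\,\mathbf{E}\big[(AX_+\vee B_+)^\kappa-(AX_+)^\kappa\big].$$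
   Context: Notation: $a\vee b=\max\{a,b\}$, $x_+=\max\{x,0\}$, $\log 0=-\infty$. $F_\kappa$ is the probability distribution function $F_\kappa(x)=\theta^{-1}\mathbf{E}[I(\log A\le x)A^\kappa]$, $x\in\mathbb{R}$, where $\theta=\mathbf{E}A^\kappa$. For $T\in(0,\infty)$ let $\Delta=(0,T]$, and for a distribution function $H$ on $\mathbb{R}$ put $H(x+\Delta)=H(x+T)-H(x)$. $H\in\mathcal{L}_\Delta$ if $H(x+t+\Delta)/H(x+\Delta)\to1$ as $x\to\infty$ uniformly in $t\in[0,1]$. $H\in\mathcal{S}_\Delta$ ($\Delta$-subexponential) if $H(x+\Delta)>0$ for all $x$ large enough, $H\in\mathcal{L}_\Delta$, and $(H*H)(x+\Delta)\sim2H(x+\Delta)$ as $x\to\infty$. $H\in\mathcal{S}_{loc}$ (locally subexponential) if $H\in\mathcal{S}_\Delta$ for every $T>0$. "The solution" refers to the law of $X$; under these assumptions it is known to exist and be unique. In the expectation, $X$ is independent of $(A,B)$. *)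

theory Defs
  imports "HOL-Probability.Probability"
begin

(* Classes of distribution functions on the real line.  A distribution function is a
   right-continuous nondecreasing H :: real => real with limits 0 and 1; the definitions below
   are only meaningful for such H. *)

(* H(x + Delta) for Delta = (0,T] *)
definition local_mass :: "real \<Rightarrow> (real \<Rightarrow> real) \<Rightarrow> real \<Rightarrow> real" where
  "local_mass T H x = H (x + T) - H x"

definition df_convolution :: "(real \<Rightarrow> real) \<Rightarrow> (real \<Rightarrow> real) \<Rightarrow> real \<Rightarrow> real" where
  "df_convolution H G = cdf (interval_measure H \<star> interval_measure G)"

definition class_L :: "real \<Rightarrow> (real \<Rightarrow> real) \<Rightarrow> bool" where
  "class_L T H \<longleftrightarrow>
     uniform_limit {0..1} (\<lambda>x t. local_mass T H (x + t) / local_mass T H x) (\<lambda>_. 1) at_top"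

definition delta_subexponential :: "real \<Rightarrow> (real \<Rightarrow> real) \<Rightarrow> bool" where
  "delta_subexponential T H \<longleftrightarrow>
     eventually (\<lambda>x. local_mass T H x > 0) at_top \<and>
     class_L T H \<and>
     local_mass T (df_convolution H H) \<sim>[at_top] (\<lambda>x. 2 * local_mass T H x)"

definition locally_subexponential :: "(real \<Rightarrow> real) \<Rightarrow> bool" where
  "locally_subexponential H \<longleftrightarrow> (\<forall>T>0. delta_subexponential T H)"

(* The logarithm with log 0 = -infinity; the library has ln 0 = 0. *)
definition ext_ln :: "real \<Rightarrow> ereal" where
  "ext_ln a = (if a = 0 then - \<infinity> else ereal (ln a))"

definition tilted_df :: "'a measure \<Rightarrow> ('a \<Rightarrow> real) \<Rightarrow> real \<Rightarrow> real \<Rightarrow> real" where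
  "tilted_df M A \<kappa> x =
     inverse (\<integral>\<omega>. A \<omega> powr \<kappa> \<partial>M) *
     (\<integral>\<omega>. indicator {\<omega>. ext_ln (A \<omega>) \<le> ereal x} \<omega> * A \<omega> powr \<kappa> \<partial>M)"

(* Not concentrated on a lattice d * Z; in particular a point mass at 0 is arithmetic. *)
definition nonarithmetic :: "real measure \<Rightarrow> bool" where
  "nonarithmetic \<mu> \<longleftrightarrow> \<not> (\<exists>d>0. AE x in \<mu>. \<exists>k::int. x = d * of_int k)"

(* The law of log A conditioned on A being nonzero *)
definition cond_log_law :: "'a measure \<Rightarrow> ('a \<Rightarrow> real) \<Rightarrow> real measure" where
  "cond_log_law M A = distr (uniform_measure M {\<omega> \<in> space M. A \<omega> \<noteq> 0}) borel (\<lambda>\<omega>. ln (A \<omega>))"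

(* Independence of the generated sigma-algebras.  The library's indep_var requires both
   variables to have the same value type, which excludes X against the pair (A,B). *)
definition indep_rvs ::
  "'a measure \<Rightarrow> 'b measure \<Rightarrow> ('a \<Rightarrow> 'b) \<Rightarrow> 'c measure \<Rightarrow> ('a \<Rightarrow> 'c) \<Rightarrow> bool" where
  "indep_rvs M S X T Y \<longleftrightarrow>
     X \<in> measurable M S \<and> Y \<in> measurable M T \<and>
     prob_space.indep_set M
       {X -` C \<inter> space M | C. C \<in> sets S}
       {Y -` C \<inter> space M | C. C \<in> sets T}"

(* X solves X = max (A X) B in law, with X independent of (A,B) *)
definition max_equation_solution ::
  "'a measure \<Rightarrow> ('a \<Rightarrow> real) \<Rightarrow> ('a \<Rightarrow> real) \<Rightarrow> ('a \<Rightarrow> real) \<Rightarrow> bool" where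
  "max_equation_solution M A B X \<longleftrightarrow>
     indep_rvs M borel X (borel \<Otimes>\<^sub>M borel) (\<lambda>\<omega>. (A \<omega>, B \<omega>)) \<and>
     distr M borel X = distr M borel (\<lambda>\<omega>. max (A \<omega> * X \<omega>) (B \<omega>))"

end

theory Submission
  imports Defs "HOL-Real_Asymp.Real_Asymp"
begin

text \<open>
  Put \<open>h x = exp (\<kappa> x) P(X > exp x)\<close> and \<open>\<psi> x = exp (\<kappa> x) P(A X \<le> exp x < B)\<close>. Under the law \<open>\<mu>\<close> of
  \<open>log A\<close> tilted by \<open>A\<^sup>\<kappa>\<close>, whose distribution function is \<open>F\<close>, the fixed point equation turns into the
  defective renewal equation \<open>h = \<psi> + \<theta> (h * \<mu>)\<close>, and \<open>\<psi>\<close> is exponentially small because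
  \<open>E |B|\<^sup>\<nu> < \<infinity>\<close>. No convolution powers are needed: in \<open>\<integral> h(x - y) \<mu>(dy)\<close> the range \<open>y > x - a\<close>
  contributes \<open>g x \<integral>\<^sub>z\<^sub><\<^sub>a h(z) dz\<close>, since \<open>\<mu>\<close> looks like \<open>g x\<close> times Lebesgue measure near \<open>x\<close>,
  while \<open>F * F \<sim> 2 F\<close> locally forces \<open>\<integral> g(x - y) \<mu>(dy) \<sim> g x\<close> over \<open>y \<le> x - a\<close>.
  Hence \<open>c = lim h/g\<close> satisfies \<open>c = \<theta> (c + \<integral> h)\<close>, where \<open>\<integral> h = \<integral> \<psi> / (1 - \<theta>)\<close>. Applied separately to the
  limit superior and the limit inferior this argument also proves convergence, once \<open>h/g\<close> is known to be
  bounded; boundedness follows by comparing \<open>h\<close> with the supersolution \<open>C g\<close>.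
\<close>

section \<open>Locally subexponential distributions\<close>

lemma (in real_distribution) local_mass_cdf:
  "T \<ge> 0 \<Longrightarrow> local_mass T (cdf M) x = measure M {x<..x + T}"
  using cdf_diff_eq[of x "x + T"] by (cases "T = 0") (auto simp: local_mass_def)

locale locally_subexponential_distribution = real_distribution \<mu> for \<mu> :: "real measure" +
  assumes loc_subexp: "locally_subexponential (cdf \<mu>)"
    and almost_decreasing:
      "\<exists>K x0. \<forall>x\<ge>x0. (SUP y\<in>{x<..}. local_mass 1 (cdf \<mu>) y) \<le> K * local_mass 1 (cdf \<mu>) x"
begin

section \<open>Shift invariance, almost monotonicity and slow decay of the local mass
  \<open>g\<close>\<close>

definition g :: "real \<Rightarrow> real" where
  "g = local_mass 1 (cdf \<mu>)"

declare events_eq_borel [measurable_cong]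

lemma g_eq: "g x = measure \<mu> {x<..x + 1}"
  unfolding g_def by (simp add: local_mass_cdf)

lemma g_nonneg [simp]: "g x \<ge> 0"
  by (simp add: g_eq)

lemma g_le_1: "g x \<le> 1"
  by (simp add: g_eq)

lemma cdf_measurable [measurable]: "cdf \<mu> \<in> borel_measurable borel"
  by (intro borel_measurable_mono monoI cdf_nondecreasing)

lemma g_measurable [measurable]: "g \<in> borel_measurable borel"
  unfolding g_def local_mass_def by measurable

lemma delta_subexp: "T > 0 \<Longrightarrow> delta_subexponential T (cdf \<mu>)"
  using loc_subexp by (simp add: locally_subexponential_def)

lemma local_mass_pos: "T > 0 \<Longrightarrow> eventually (\<lambda>x. local_mass T (cdf \<mu>) x > 0) at_top"
  using delta_subexp by (simp add: delta_subexponential_def)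

lemma local_mass_shift_01:
  assumes "T > 0" "0 \<le> t" "t \<le> 1"
  shows "((\<lambda>x. local_mass T (cdf \<mu>) (x + t) / local_mass T (cdf \<mu>) x) \<longlongrightarrow> 1) at_top"
proof -
  have "class_L T (cdf \<mu>)"
    using delta_subexp[OF assms(1)] by (simp add: delta_subexponential_def)
  then show ?thesis
    unfolding class_L_def using assms by (auto dest!: tendsto_uniform_limitI)
qed

lemma g_pos: "eventually (\<lambda>x. g x > 0) at_top"
  using local_mass_pos[of 1] by (simp add: g_def)

text \<open>The hypothesis covers shifts in \<open>[0,1]\<close>. Admissible shifts are closed under
  addition, since the two quotients multiply, and under negation, since the quotient taken at
  \<open>x - t\<close> can be inverted. Integer and fractional parts then reach every real
  \<open>t\<close>.\<close>

lemma g_shift: "((\<lambda>x. g (x + t) / g x) \<longlongrightarrow> 1) at_top"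
proof -
  let ?P = "\<lambda>t. ((\<lambda>x. g (x + t) / g x) \<longlongrightarrow> 1) at_top"
  have base: "?P t" if "0 \<le> t" "t \<le> 1" for t
    using local_mass_shift_01[of 1 t] that by (simp add: g_def)
  have plus: "?P (s + t)" if "?P s" "?P t" for s t
  proof -
    have "((\<lambda>x. g ((x + s) + t) / g (x + s)) \<longlongrightarrow> 1) at_top"
      by (rule filterlim_compose[OF \<open>?P t\<close>]) real_asymp
    from tendsto_mult[OF this \<open>?P s\<close>]
    have "((\<lambda>x. g ((x + s) + t) / g (x + s) * (g (x + s) / g x)) \<longlongrightarrow> 1) at_top" by simp
    moreover have "eventually (\<lambda>x. g (x + s) > 0) at_top"
      by (rule eventually_compose_filterlim[OF g_pos]) real_asymp
    ultimately show ?thesis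
      by (elim Lim_transform_eventually) (auto elim!: eventually_mono simp: add.assoc)
  qed
  have minus: "?P (- t)" if "?P t" for t
  proof -
    have "((\<lambda>x. g ((x - t) + t) / g (x - t)) \<longlongrightarrow> 1) at_top"
      by (rule filterlim_compose[OF that]) real_asymp
    from tendsto_inverse[OF this] show ?thesis by simp
  qed
  have nat: "?P (real n)" for n
  proof (induction n)
    case 0 then show ?case using base[of 0] by simp
  next
    case (Suc n) then show ?case using plus[OF Suc base[of 1]] by (simp add: add.commute)
  qed
  have int: "?P (of_int k)" for k
    by (cases k rule: int_cases2) (use nat minus[OF nat] in \<open>auto\<close>)
  show ?thesis
    using plus[OF int[of "\<lfloor>t\<rfloor>"] base[of "frac t"]] frac_lt_1[of t] frac_ge_0[of t] by (simp add: frac_def)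
qed

text \<open>Pointwise form of the supremum condition. Replacing \<open>K\<close> by
  \<open>max K 1\<close> covers \<open>y = x\<close>, which the open ray leaves out, and makes the
  constant positive.\<close>

lemma g_dominates:
  obtains K x0 where "K > 0" "\<And>x. x \<ge> x0 \<Longrightarrow> g x > 0" "\<And>x y. x0 \<le> x \<Longrightarrow> x \<le> y \<Longrightarrow> g y \<le> K * g x"
proof -
  obtain K x0 where K: "\<And>x. x \<ge> x0 \<Longrightarrow> (SUP y\<in>{x<..}. g y) \<le> K * g x"
    using almost_decreasing unfolding g_def by blast
  obtain x1 where x1: "\<And>x. x \<ge> x1 \<Longrightarrow> g x > 0"
    using g_pos by (auto simp: eventually_at_top_linorder)
  show thesis
  proof (rule that[of "max K 1" "max x0 x1"])
    fix x y assume xy: "max x0 x1 \<le> x" "x \<le> y"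
    show "g y \<le> max K 1 * g x"
    proof (cases "x = y")
      case True then show ?thesis using mult_right_mono[of 1 "max K 1" "g x"] by simp
    next
      case False
      \<comment> \<open>A real supremum bounds the members of a set only if the set is bounded
        above, which \<open>g \<le> 1\<close> guarantees.\<close>
      then have "g y \<le> (SUP y\<in>{x<..}. g y)"
        using xy by (intro cSUP_upper bdd_aboveI[of _ 1]) (auto simp: g_le_1)
      also have "\<dots> \<le> K * g x" using K xy by simp
      also have "\<dots> \<le> max K 1 * g x" by (intro mult_right_mono) auto
      finally show ?thesis .
    qed
  qed (use x1 in auto)
qed

text \<open>A unit window is the union of \<open>m\<close> windows of length \<open>1/m\<close>,
  whose masses are asymptotically equal by the shift property for that length. So \<open>g\<close>
  is asymptotically \<open>m\<close> times the mass of one of them.\<close>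

lemma local_mass_ratio:
  assumes "m > 0"
  shows "((\<lambda>x. local_mass (1 / real m) (cdf \<mu>) x / g x) \<longlongrightarrow> 1 / real m) at_top"
proof -
  let ?l = "local_mass (1 / real m) (cdf \<mu>)"
  have sum: "g x = (\<Sum>i<m. ?l (x + real i / real m))" for x
  proof -
    have "(\<Sum>i<n. ?l (x + real i / real m)) = cdf \<mu> (x + real n / real m) - cdf \<mu> x" for n
      by (induction n) (auto simp: local_mass_def add_divide_distrib algebra_simps)
    from this[of m] show ?thesis using assms by (simp add: g_def local_mass_def)
  qed
  have "((\<lambda>x. \<Sum>i<m. ?l (x + real i / real m) / ?l x) \<longlongrightarrow> (\<Sum>i<m. 1)) at_top"
    using assms by (intro tendsto_sum local_mass_shift_01) auto
  then have "((\<lambda>x. g x / ?l x) \<longlongrightarrow> real m) at_top"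
    by (simp add: sum sum_divide_distrib)
  from tendsto_inverse[OF this] show ?thesis using assms by (simp add: inverse_eq_divide)
qed

text \<open>As \<open>g (x + 1) / g x\<close> tends to one, a unit step eventually costs
  \<open>g\<close> at most the factor \<open>exp (- \<delta>)\<close>, which is exactly what the
  exponential loses. A bound on one unit interval therefore propagates to the right.\<close>

lemma exp_bound:
  assumes "\<delta> > 0"
  obtains C where "eventually (\<lambda>x. exp (- \<delta> * x) \<le> C * g x) at_top"
proof -
  obtain K x0 where K: "K > 0" "\<And>x. x \<ge> x0 \<Longrightarrow> g x > 0"
      "\<And>x y. x0 \<le> x \<Longrightarrow> x \<le> y \<Longrightarrow> g y \<le> K * g x"
    by (rule g_dominates) blast
  have "eventually (\<lambda>x. g (x + 1) / g x > exp (- \<delta>)) at_top"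
    using assms by (intro order_tendstoD(1)[OF g_shift]) auto
  then obtain x1 where x1: "\<And>x. x \<ge> x1 \<Longrightarrow> g (x + 1) / g x > exp (- \<delta>)"
    by (auto simp: eventually_at_top_linorder)
  define x2 where "x2 = max x0 x1"
  \<comment> \<open>Chosen so that the bound holds on \<open>[x2, x2 + 1]\<close>, where almost
    monotonicity gives \<open>g x \<ge> g (x2 + 1) / K\<close>.\<close>
  define C where "C = exp (- \<delta> * x2) * K / g (x2 + 1)"
  have gp: "g x > 0" if "x \<ge> x2" for x using K that by (auto simp: x2_def)
  have C: "C > 0" using K gp[of "x2 + 1"] by (simp add: C_def)
  have step: "exp (- \<delta> * x) \<le> C * g x" if "x \<ge> x2" "x \<le> x2 + real n + 1" for x n
    using that
  proof (induction n arbitrary: x)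
    case 0
    have "exp (- \<delta> * x) \<le> exp (- \<delta> * x2)" using 0 assms by simp
    also have "\<dots> = C * (g (x2 + 1) / K)" using K gp[of "x2 + 1"] by (simp add: C_def)
    also have "\<dots> \<le> C * g x"
      using C 0 K(1) K(3)[of x "x2 + 1"]
      by (intro mult_left_mono) (auto simp: x2_def field_simps)
    finally show ?case .
  next
    case (Suc n)
    show ?case
    proof (cases "x \<le> x2 + 1")
      case True
      have "exp (- \<delta> * x) \<le> exp (- \<delta> * x2)" using Suc assms by simp
      also have "\<dots> = C * (g (x2 + 1) / K)" using K gp[of "x2 + 1"] by (simp add: C_def)
      also have "\<dots> \<le> C * g x"
        using C True Suc K(1) K(3)[of x "x2 + 1"]
        by (intro mult_left_mono) (auto simp: x2_def field_simps)
      finally show ?thesis .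
    next
      case False
      then have "exp (- \<delta> * (x - 1)) \<le> C * g (x - 1)" using Suc by auto
      then have "exp (- \<delta>) * exp (- \<delta> * (x - 1)) \<le> exp (- \<delta>) * (C * g (x - 1))"
        by (intro mult_left_mono) auto
      also have "\<dots> = C * (exp (- \<delta>) * g (x - 1))" by simp
      also have "exp (- \<delta>) * g (x - 1) \<le> g x"
      proof -
        have "x - 1 \<ge> x1" using False by (auto simp: x2_def)
        from x1[OF this] show ?thesis
          using gp[of "x - 1"] False by (simp add: pos_less_divide_eq)
      qed
      then have "C * (exp (- \<delta>) * g (x - 1)) \<le> C * g x" using C by (intro mult_left_mono) auto
      finally show ?thesis by (simp add: exp_add[symmetric] algebra_simps)
    qed
  qed
  have "exp (- \<delta> * x) \<le> C * g x" if "x \<ge> x2" for x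
    using step[OF that, of "nat \<lceil>x - x2\<rceil>"] that by linarith
  then show thesis using that by (auto simp: eventually_at_top_linorder)
qed

text \<open>Half of the rate pays for the comparison with \<open>g\<close>; the other half remains
  as decay.\<close>

lemma exp_negligible:
  assumes "\<delta> > 0"
  shows "((\<lambda>x. exp (- \<delta> * x) / g x) \<longlongrightarrow> 0) at_top"
proof -
  obtain C where C: "eventually (\<lambda>x. exp (- (\<delta> / 2) * x) \<le> C * g x) at_top"
    by (rule exp_bound[of "\<delta> / 2"]) (use assms in auto)
  have lim: "((\<lambda>x. C * exp (- (\<delta> / 2) * x)) \<longlongrightarrow> 0) at_top"
    using assms by real_asymp
  have le: "eventually (\<lambda>x. exp (- \<delta> * x) / g x \<le> C * exp (- (\<delta> / 2) * x)) at_top"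
    using C g_pos
  proof eventually_elim
    case (elim x)
    have "exp (- \<delta> * x) = exp (- (\<delta> / 2) * x) * exp (- (\<delta> / 2) * x)"
      by (simp add: exp_add[symmetric])
    also have "\<dots> \<le> exp (- (\<delta> / 2) * x) * (C * g x)" using elim by (intro mult_left_mono) auto
    finally show ?case using elim by (simp add: field_simps)
  qed
  show ?thesis
    by (rule tendsto_sandwich[OF _ le tendsto_const lim]) auto
qed

section \<open>Convolution of \<open>g\<close> with \<open>\<mu>\<close>: bounded jumps, the total,
  and the truncated integral\<close>

lemma near_origin:
  "((\<lambda>x. (\<integral>y. indicator {-L..L} y * g (x - y) \<partial>\<mu>) / g x) \<longlongrightarrow> measure \<mu> {-L..L}) at_top"
proof -
  obtain K x0 where K: "K > 0" "\<And>x. x \<ge> x0 \<Longrightarrow> g x > 0"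
      "\<And>x y. x0 \<le> x \<Longrightarrow> x \<le> y \<Longrightarrow> g y \<le> K * g x"
    by (rule g_dominates) blast
  \<comment> \<open>Shift invariance gives the pointwise limit. For \<open>y \<le> L\<close> the
    point \<open>x - y\<close> lies to the right of \<open>x - L\<close>, so
    \<open>g (x - y) \<le> K * g (x - L) \<le> 2 * K * g x\<close> gives a constant
    majorant.\<close>
  have "((\<lambda>x. \<integral>y. indicator {-L..L} y * (g (x - y) / g x) \<partial>\<mu>) \<longlongrightarrow> (\<integral>y. indicator {-L..L} y \<partial>\<mu>)) at_top"
  proof (rule integral_dominated_convergence_at_top[where w = "\<lambda>_. K * 2"])
    show "AE y in \<mu>. ((\<lambda>x. indicator {-L..L} y * (g (x - y) / g x)) \<longlongrightarrow> indicator {-L..L} y) at_top"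
    proof (intro AE_I2)
      fix y
      show "((\<lambda>x. indicator {-L..L} y * (g (x - y) / g x)) \<longlongrightarrow> indicator {-L..L} y) at_top"
        using tendsto_mult[OF tendsto_const[of "indicator {-L..L} y :: real"] g_shift[of "- y"]] by simp
    qed
    have "eventually (\<lambda>x. g (x + (- L)) / g x < 2) at_top"
      by (intro order_tendstoD(2)[OF g_shift]) auto
    moreover have "eventually (\<lambda>x. x \<ge> x0 + \<bar>L\<bar>) at_top" by (rule eventually_ge_at_top)
    ultimately show "\<forall>\<^sub>F x in at_top. AE y in \<mu>. norm (indicator {-L..L} y * (g (x - y) / g x)) \<le> K * 2"
    proof eventually_elim
      case (elim x)
      have gp: "g x > 0" using elim K by auto
      have "g (x - y) / g x \<le> K * 2" if "y \<in> {-L..L}" for y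
      proof -
        have "g (x - y) \<le> K * g (x - L)" using K(3)[of "x - L" "x - y"] that elim by auto
        also have "\<dots> \<le> K * (2 * g x)"
          using elim gp K(1) by (intro mult_left_mono) (auto simp: field_simps)
        finally show ?thesis using gp by (simp add: field_simps)
      qed
      then show ?case by (intro AE_I2) (auto simp: indicator_def K(1) less_imp_le)
    qed
  qed auto
  then show ?thesis by simp
qed

lemma integrable_g_conv: "integrable \<mu> (\<lambda>y. g (x - y))"
  by (rule integrable_const_bound[of _ 1]) (auto simp: g_le_1)

lemma integrable_g_conv_ind:
  "A \<in> sets borel \<Longrightarrow> integrable \<mu> (\<lambda>y. indicator A y * g (x - y))"
  by (rule integrable_const_bound[of _ 1]) (auto simp: g_le_1 indicator_def)

lemma g_convolution: "local_mass 1 (df_convolution (cdf \<mu>) (cdf \<mu>)) x = (\<integral>y. g (x - y) \<partial>\<mu>)"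
proof -
  \<comment> \<open>The convolution of distribution functions goes through
    \<open>interval_measure\<close>; uniqueness of the measure with a given distribution function
    leads back to \<open>\<mu>\<close>.\<close>
  have eq: "interval_measure (cdf \<mu>) = \<mu>"
    by (rule cdf_unique)
      (auto intro!: real_distribution_interval_measure cdf_interval_measure cdf_nondecreasing
         cdf_is_right_cont cdf_lim_at_top_prob cdf_lim_at_bot real_distribution_axioms)
  interpret C: real_distribution "\<mu> \<star> \<mu>"
    unfolding convolution_def real_distribution_def real_distribution_axioms_def
    by (auto intro!: prob_space.prob_space_distr prob_space_pair prob_space_axioms)
  have "ennreal (measure (\<mu> \<star> \<mu>) {x<..x + 1}) = (\<integral>\<^sup>+y. emeasure \<mu> {a. a + y \<in> {x<..x + 1}} \<partial>\<mu>)"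
    by (subst C.emeasure_eq_measure[symmetric], subst convolution_emeasure)
       (auto intro: finite_measure_axioms)
  also have "\<dots> = (\<integral>\<^sup>+y. ennreal (g (x - y)) \<partial>\<mu>)"
    by (intro nn_integral_cong)
       (auto simp: g_eq emeasure_eq_measure intro!: arg_cong[where f = "measure \<mu>"])
  also have "\<dots> = ennreal (\<integral>y. g (x - y) \<partial>\<mu>)"
    by (intro nn_integral_eq_integral integrable_g_conv) auto
  finally show ?thesis
    by (simp add: df_convolution_def eq C.local_mass_cdf)
qed

lemma conv_asymp: "((\<lambda>x. (\<integral>y. g (x - y) \<partial>\<mu>) / g x) \<longlongrightarrow> 2) at_top"
proof -
  have "local_mass 1 (df_convolution (cdf \<mu>) (cdf \<mu>)) \<sim>[at_top] (\<lambda>x. 2 * g x)"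
    using delta_subexp[of 1] by (simp add: delta_subexponential_def g_def)
  then have "((\<lambda>x. (\<integral>y. g (x - y) \<partial>\<mu>) / (2 * g x)) \<longlongrightarrow> 1) at_top"
    unfolding g_convolution[abs_def]
    by (rule asymp_equivD_strong) (use g_pos in \<open>auto elim: eventually_mono\<close>)
  from tendsto_mult[OF this tendsto_const[of 2]] show ?thesis by simp
qed

text \<open>The event that the sum of two independent jumps lies in \<open>(x, x + 1]\<close> and the second is at most \<open>L\<close>
  forces the first to exceed \<open>x - L\<close>.\<close>

lemma conv_swap:
  "(\<integral>y. indicator {..L} y * g (x - y) \<partial>\<mu>) \<le> (\<integral>y. indicator {x - L<..} y * g (x - y) \<partial>\<mu>)"
proof -
  interpret P: pair_sigma_finite \<mu> \<mu> ..
  \<comment> \<open>Both sides become product measures of regions in the plane of the two jumps, so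
    that Tonelli can exchange the roles of the jumps.\<close>
  have rep: "ennreal (\<integral>y. indicator A y * g (x - y) \<partial>\<mu>) =
      (\<integral>\<^sup>+y. (\<integral>\<^sup>+z. indicator A y * indicator {x<..x + 1} (y + z) \<partial>\<mu>) \<partial>\<mu>)"
    if [measurable]: "A \<in> sets borel" for A
  proof -
    have "ennreal (\<integral>y. indicator A y * g (x - y) \<partial>\<mu>) = (\<integral>\<^sup>+y. ennreal (indicator A y * g (x - y)) \<partial>\<mu>)"
      using that by (intro nn_integral_eq_integral[symmetric] integrable_g_conv_ind) auto
    also have "\<dots> = (\<integral>\<^sup>+y. (\<integral>\<^sup>+z. indicator A y * indicator {x<..x + 1} (y + z) \<partial>\<mu>) \<partial>\<mu>)"
    proof (intro nn_integral_cong)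
      fix y
      have "(\<integral>\<^sup>+z. indicator A y * indicator {x<..x + 1} (y + z) \<partial>\<mu>) =
          indicator A y * (\<integral>\<^sup>+z. indicator {x - y<..x - y + 1} z \<partial>\<mu>)"
        by (subst nn_integral_cmult[symmetric]) (auto intro!: nn_integral_cong simp: indicator_def)
      also have "\<dots> = ennreal (indicator A y * g (x - y))"
        by (cases "y \<in> A") (simp_all add: g_eq emeasure_eq_measure)
      finally show "ennreal (indicator A y * g (x - y)) = (\<integral>\<^sup>+z. indicator A y * indicator {x<..x + 1} (y + z) \<partial>\<mu>)"
        by simp
    qed
    finally show ?thesis .
  qed
  have "ennreal (\<integral>y. indicator {..L} y * g (x - y) \<partial>\<mu>) =
      (\<integral>\<^sup>+y. (\<integral>\<^sup>+z. indicator {..L} z * indicator {x<..x + 1} (z + y) \<partial>\<mu>) \<partial>\<mu>)"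
    by (subst rep) (auto intro!: P.Fubini')
  also have "\<dots> \<le> (\<integral>\<^sup>+y. (\<integral>\<^sup>+z. indicator {x - L<..} y * indicator {x<..x + 1} (y + z) \<partial>\<mu>) \<partial>\<mu>)"
    by (intro nn_integral_mono) (auto simp: indicator_def)
  also have "\<dots> = ennreal (\<integral>y. indicator {x - L<..} y * g (x - y) \<partial>\<mu>)"
    by (subst rep) auto
  finally show ?thesis
    by (subst (asm) ennreal_le_iff) (auto intro!: integral_nonneg_AE)
qed

lemma central_mass: "\<epsilon> > 0 \<Longrightarrow> \<exists>L. measure \<mu> {-L..L} > 1 - \<epsilon>"
proof -
  assume "\<epsilon> > 0"
  have "(\<lambda>n. measure \<mu> {- real n..real n}) \<longlonglongrightarrow> measure \<mu> (\<Union>n. {- real n..real n})"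
    by (intro finite_Lim_measure_incseq) (auto simp: incseq_def)
  moreover have "(\<Union>n. {- real n..real n}) = UNIV"
  proof (intro equalityI subsetI UN_I)
    fix x :: real show "x \<in> {- real (nat \<lceil>\<bar>x\<bar>\<rceil>)..real (nat \<lceil>\<bar>x\<bar>\<rceil>)}" by (simp; linarith)
  qed auto
  ultimately have "(\<lambda>n. measure \<mu> {- real n..real n}) \<longlonglongrightarrow> 1"
    using prob_space by simp
  then have "eventually (\<lambda>n. measure \<mu> {- real n..real n} > 1 - \<epsilon>) sequentially"
    using \<open>\<epsilon> > 0\<close> by (intro order_tendstoD) auto
  then show ?thesis by (auto simp: eventually_sequentially)
qed

text \<open>Of the total of about \<open>2 * g x\<close>, about \<open>g x\<close> comes from
  bounded jumps, and by \<open>conv_swap\<close> at least as much comes from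
  \<open>y > x - a\<close>. What is left for \<open>y \<le> x - a\<close> is at most about
  \<open>g x\<close>, and it contains the contribution of the bounded jumps.\<close>

lemma truncated_conv:
  assumes "\<epsilon> > 0"
  shows "eventually (\<lambda>a. eventually (\<lambda>x.
    (1 - \<epsilon>) * g x \<le> (\<integral>y. indicator {..x - a} y * g (x - y) \<partial>\<mu>) \<and>
    (\<integral>y. indicator {..x - a} y * g (x - y) \<partial>\<mu>) \<le> (1 + \<epsilon>) * g x) at_top) at_top"
proof -
  obtain L where L: "measure \<mu> {-L..L} > 1 - \<epsilon> / 2"
    using central_mass[of "\<epsilon> / 2"] assms by auto
  have "eventually (\<lambda>x.
    (1 - \<epsilon>) * g x \<le> (\<integral>y. indicator {..x - a} y * g (x - y) \<partial>\<mu>) \<and>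
    (\<integral>y. indicator {..x - a} y * g (x - y) \<partial>\<mu>) \<le> (1 + \<epsilon>) * g x) at_top" if a: "a \<ge> L" for a
  proof -
    have "eventually (\<lambda>x. (\<integral>y. indicator {-L..L} y * g (x - y) \<partial>\<mu>) / g x > 1 - \<epsilon> / 2) at_top"
      by (intro order_tendstoD(1)[OF near_origin] L)
    moreover have "eventually (\<lambda>x. (\<integral>y. g (x - y) \<partial>\<mu>) / g x < 2 + \<epsilon> / 2) at_top"
      using assms by (intro order_tendstoD(2)[OF conv_asymp]) auto
    \<comment> \<open>This places \<open>{-L..L}\<close> inside \<open>{..x - a}\<close>.\<close>
    moreover have "eventually (\<lambda>x. x \<ge> a + L) at_top" by (rule eventually_ge_at_top)
    ultimately show ?thesis using g_pos
    proof eventually_elim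
      case (elim x)
      let ?I = "\<lambda>A. (\<integral>y. indicator A y * g (x - y) \<partial>\<mu>)"
      have mono: "?I A \<le> ?I B" if "A \<subseteq> B" "A \<in> sets borel" "B \<in> sets borel" for A B
        using that by (intro integral_mono integrable_g_conv_ind) (auto simp: indicator_def)
      have near: "?I {-L..L} > (1 - \<epsilon> / 2) * g x" using elim by (simp add: field_simps)
      have total: "(\<integral>y. g (x - y) \<partial>\<mu>) < (2 + \<epsilon> / 2) * g x" using elim by (simp add: field_simps)
      have "(\<integral>y. g (x - y) \<partial>\<mu>) =
          (\<integral>y. indicator {..x - a} y * g (x - y) + indicator {x - a<..} y * g (x - y) \<partial>\<mu>)"
        by (intro Bochner_Integration.integral_cong) (auto simp: indicator_def)
      also have "\<dots> = ?I {..x - a} + ?I {x - a<..}"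
        by (intro Bochner_Integration.integral_add integrable_g_conv_ind) auto
      finally have split: "(\<integral>y. g (x - y) \<partial>\<mu>) = ?I {..x - a} + ?I {x - a<..}" .
      have "(1 - \<epsilon>) * g x \<le> (1 - \<epsilon> / 2) * g x" using assms by (intro mult_right_mono) auto
      also have "\<dots> \<le> ?I {-L..L}" using near by simp
      also have "\<dots> \<le> ?I {..x - a}" using elim by (intro mono) auto
      finally have 1: "(1 - \<epsilon>) * g x \<le> ?I {..x - a}" .
      \<comment> \<open>Since \<open>a \<ge> L\<close>, the share of the central jumps also bounds
        the share beyond \<open>x - a\<close> from below; subtracting it from the total gives the
        upper estimate.\<close>
      have "(1 - \<epsilon> / 2) * g x \<le> ?I {-L..L}" using near by simp
      also have "\<dots> \<le> ?I {..a}" using a by (intro mono) auto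
      also have "\<dots> \<le> ?I {x - a<..}" by (rule conv_swap)
      finally have "?I {..x - a} \<le> (2 + \<epsilon> / 2) * g x - (1 - \<epsilon> / 2) * g x"
        using split total by linarith
      also have "\<dots> = (1 + \<epsilon>) * g x" by (simp add: algebra_simps)
      finally show ?case using 1 by simp
    qed
  qed
  then show ?thesis by (rule eventually_at_top_linorderI)
qed

lemma truncated_conv_le:
  assumes "\<epsilon> > 0"
  shows "eventually (\<lambda>a. eventually (\<lambda>x.
    (\<integral>y. indicator {..x - a} y * g (x - y) \<partial>\<mu>) \<le> (1 + \<epsilon>) * g x) at_top) at_top"
  by (rule eventually_mono[OF truncated_conv[OF assms]]) (erule eventually_mono, blast)

lemma truncated_conv_ge:
  assumes "\<epsilon> > 0"
  shows "eventually (\<lambda>a. eventually (\<lambda>x.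
    (1 - \<epsilon>) * g x \<le> (\<integral>y. indicator {..x - a} y * g (x - y) \<partial>\<mu>)) at_top) at_top"
  by (rule eventually_mono[OF truncated_conv[OF assms]]) (erule eventually_mono, blast)

end

section \<open>The defective renewal equation\<close>

lemma nn_integral_exp_lessThan:
  fixes a \<kappa> :: real
  assumes "\<kappa> > 0"
  shows "(\<integral>\<^sup>+w. ennreal (indicator {..<a} w * exp (\<kappa> * w)) \<partial>lborel) = ennreal (exp (\<kappa> * a) / \<kappa>)"
proof -
  have "(\<integral>\<^sup>+w. ennreal (indicator {..<a} w * exp (\<kappa> * w)) \<partial>lborel) =
      (\<integral>\<^sup>+w. ennreal (indicator {..<a} (- w) * exp (- \<kappa> * w)) \<partial>lborel)"
    by (subst nn_integral_real_affine[where c = "-1" and t = 0]) auto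
  \<comment> \<open>After the reflection the fundamental theorem applies on a closed right
    half-line; its endpoint is a null set.\<close>
  also have "\<dots> = (\<integral>\<^sup>+w. ennreal (exp (- \<kappa> * w)) * indicator {- a..} w \<partial>lborel)"
    using AE_lborel_singleton[of "- a"]
    by (intro nn_integral_cong_AE) (auto elim!: eventually_mono simp: indicator_def)
  also have "\<dots> = ennreal (0 - (- exp (- \<kappa> * (- a)) / \<kappa>))"
  proof (rule nn_integral_FTC_atLeast)
    show "((\<lambda>w. - exp (- \<kappa> * w) / \<kappa>) \<longlongrightarrow> 0) at_top"
      using assms by real_asymp
  qed (use assms in \<open>auto intro!: derivative_eq_intros\<close>)
  finally show ?thesis by simp
qed

lemma has_bochner_integral_exp_lessThan:
  fixes a \<kappa> :: real
  assumes "\<kappa> > 0"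
  shows "has_bochner_integral lborel (\<lambda>w. indicator {..<a} w * exp (\<kappa> * w)) (exp (\<kappa> * a) / \<kappa>)"
  using assms nn_integral_exp_lessThan[OF assms]
  by (intro has_bochner_integral_nn_integral) auto

text \<open>\<open>G x\<close> plays the role of \<open>P(X > exp x)\<close>. The bound in
  \<open>exp_moment\<close> reflects that undoing the tilt turns \<open>\<theta> \<mu>\<close> into
  the law of \<open>log A\<close> on \<open>A > 0\<close>, of mass at most one; it makes
  \<open>exp (\<kappa> x)\<close> a supersolution of the homogeneous equation.\<close>

locale locally_subexponential_renewal = locally_subexponential_distribution +
  fixes \<kappa> \<theta> \<delta> C0 :: real and G \<psi> :: "real \<Rightarrow> real"
  assumes kappa: "\<kappa> > 0" and theta: "0 < \<theta>" "\<theta> < 1" and delta: "\<delta> > 0"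
    and G_antimono: "antimono G" and G_nonneg: "\<And>x. 0 \<le> G x" and G_le_1: "\<And>x. G x \<le> 1"
    and G_lim: "(G \<longlongrightarrow> 0) at_top"
    and psi_meas [measurable]: "\<psi> \<in> borel_measurable borel"
    and psi_nonneg: "\<And>x. 0 \<le> \<psi> x"
    and psi_bound: "\<And>x. x \<ge> 0 \<Longrightarrow> \<psi> x \<le> C0 * exp (- \<delta> * x)"
    and exp_moment: "integrable \<mu> (\<lambda>y. exp (- \<kappa> * y))" "\<theta> * (\<integral>y. exp (- \<kappa> * y) \<partial>\<mu>) \<le> 1"
    and renewal: "\<And>x. exp (\<kappa> * x) * G x = \<psi> x + \<theta> * (\<integral>y. exp (\<kappa> * (x - y)) * G (x - y) \<partial>\<mu>)"
begin

section \<open>Growth of \<open>h\<close> and subsolutions of the homogeneous equation\<close>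

definition h :: "real \<Rightarrow> real" where
  "h x = exp (\<kappa> * x) * G x"

lemma renewal_h: "h x = \<psi> x + \<theta> * (\<integral>y. h (x - y) \<partial>\<mu>)"
  unfolding h_def by (rule renewal)

lemma G_measurable [measurable]: "G \<in> borel_measurable borel"
proof -
  have "(\<lambda>x. - G x) \<in> borel_measurable borel"
    using G_antimono by (intro borel_measurable_mono) (auto simp: mono_def antimono_def)
  then show ?thesis by simp
qed

lemma h_measurable [measurable]: "h \<in> borel_measurable borel"
  unfolding h_def[abs_def] by measurable

lemma h_nonneg [simp]: "0 \<le> h x"
  by (simp add: h_def G_nonneg)

lemma h_le_exp: "h x \<le> exp (\<kappa> * x)"
  using G_le_1[of x] by (simp add: h_def)

text \<open>Monotonicity of \<open>G\<close> limits the growth of \<open>h\<close> but not its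
  decay, so a value of \<open>h\<close> is always bounded through a value further to the
  left.\<close>

lemma h_growth: "z \<le> w \<Longrightarrow> h w \<le> exp (\<kappa> * (w - z)) * h z"
proof -
  assume "z \<le> w"
  then have "G w \<le> G z" using G_antimono by (auto simp: antimono_def)
  then have "exp (\<kappa> * w) * G w \<le> exp (\<kappa> * w) * G z" by simp
  then show ?thesis
    by (simp add: h_def mult.assoc[symmetric] exp_add[symmetric] algebra_simps)
qed

lemma integrable_exp_conv: "integrable \<mu> (\<lambda>y. exp (\<kappa> * (x - y)))"
proof -
  have "integrable \<mu> (\<lambda>y. exp (\<kappa> * x) * exp (- \<kappa> * y))"
    by (intro integrable_mult_right exp_moment)
  then show ?thesis by (simp add: exp_add[symmetric] algebra_simps)
qed

lemma exp_conv_le: "\<theta> * (\<integral>y. exp (\<kappa> * (x - y)) \<partial>\<mu>) \<le> exp (\<kappa> * x)"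
proof -
  have "(\<integral>y. exp (\<kappa> * (x - y)) \<partial>\<mu>) = (\<integral>y. exp (\<kappa> * x) * exp (- \<kappa> * y) \<partial>\<mu>)"
    by (simp add: exp_add[symmetric] algebra_simps)
  also have "\<dots> = exp (\<kappa> * x) * (\<integral>y. exp (- \<kappa> * y) \<partial>\<mu>)" by simp
  finally show ?thesis using mult_left_mono[OF exp_moment(2), of "exp (\<kappa> * x)"] by (simp add: mult_ac)
qed

lemma integrable_conv_le_h:
  assumes [measurable]: "f \<in> borel_measurable borel" and "\<And>y. 0 \<le> f y" "\<And>y. f y \<le> h y"
  shows "integrable \<mu> (\<lambda>y. f (x - y))"
proof (rule Bochner_Integration.integrable_bound[OF integrable_exp_conv[of x]])
  show "AE y in \<mu>. norm (f (x - y)) \<le> norm (exp (\<kappa> * (x - y)))"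
    using assms(2,3) h_le_exp order_trans by (intro AE_I2) fastforce
qed measurable

lemma integrable_h_ind:
  assumes [measurable]: "A \<in> sets borel"
  shows "integrable \<mu> (\<lambda>y. indicator A y * h (x - y))"
proof (rule Bochner_Integration.integrable_bound[OF integrable_exp_conv[of x]])
  show "AE y in \<mu>. norm (indicator A y * h (x - y)) \<le> norm (exp (\<kappa> * (x - y)))"
    using h_le_exp by (intro AE_I2) (auto simp: indicator_def)
qed measurable

text \<open>The constants are contracted by the factor \<open>\<theta>\<close> and the function \<open>exp (\<kappa> x)\<close> is not increased by the
  renewal operator, while \<open>h\<close> is at most a constant plus an arbitrarily small multiple of \<open>exp (\<kappa> x)\<close>.\<close>

lemma subsolution_eq_0:
  assumes [measurable]: "f \<in> borel_measurable borel" and f: "\<And>y. 0 \<le> f y" "\<And>y. f y \<le> h y"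
    and sub: "\<And>x. f x \<le> \<theta> * (\<integral>y. f (x - y) \<partial>\<mu>)"
  shows "f x = 0"
proof -
  have "f x \<le> \<epsilon> * exp (\<kappa> * x)" if "\<epsilon> > 0" for \<epsilon>
  proof -
    have "eventually (\<lambda>x. G x < \<epsilon>) at_top"
      using that by (intro order_tendstoD(2)[OF G_lim])
    \<comment> \<open>Beyond \<open>N\<close>, \<open>h\<close> is below
      \<open>\<epsilon> * exp (\<kappa> * x)\<close>; up to \<open>N\<close> it is at most the
      constant \<open>exp (\<kappa> * N)\<close>. The sum of the two starts the iteration.\<close>
    then obtain N where N: "\<And>x. x \<ge> N \<Longrightarrow> G x < \<epsilon>"
      by (auto simp: eventually_at_top_linorder)
    have it: "f x \<le> \<theta> ^ n * exp (\<kappa> * N) + \<epsilon> * exp (\<kappa> * x)" for n x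
    proof (induction n arbitrary: x)
      case 0
      show ?case
      proof (cases "x \<le> N")
        case True
        have "f x \<le> exp (\<kappa> * x)" using f h_le_exp order_trans by blast
        also have "\<dots> \<le> exp (\<kappa> * N)" using True kappa by simp
        finally show ?thesis using that by (simp add: add_increasing2)
      next
        case False
        then have "h x \<le> \<epsilon> * exp (\<kappa> * x)" using N[of x] by (simp add: h_def)
        then show ?thesis using f(2)[of x] by (simp add: add_increasing)
      qed
    next
      case (Suc n)
      have "f x \<le> \<theta> * (\<integral>y. f (x - y) \<partial>\<mu>)" by (rule sub)
      also have "\<dots> \<le> \<theta> * (\<integral>y. \<theta> ^ n * exp (\<kappa> * N) + \<epsilon> * exp (\<kappa> * (x - y)) \<partial>\<mu>)"
        using theta f
        by (intro mult_left_mono integral_mono[OF integrable_conv_le_h[of f]] Suc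
          Bochner_Integration.integrable_add integrable_mult_right integrable_exp_conv) auto
      also have "\<dots> = \<theta> ^ Suc n * exp (\<kappa> * N) + \<epsilon> * (\<theta> * (\<integral>y. exp (\<kappa> * (x - y)) \<partial>\<mu>))"
      proof -
        have "(\<integral>y. \<theta> ^ n * exp (\<kappa> * N) + \<epsilon> * exp (\<kappa> * (x - y)) \<partial>\<mu>) =
            (\<integral>y. \<theta> ^ n * exp (\<kappa> * N) \<partial>\<mu>) + (\<integral>y. \<epsilon> * exp (\<kappa> * (x - y)) \<partial>\<mu>)"
          by (intro Bochner_Integration.integral_add integrable_mult_right integrable_exp_conv) simp
        also have "\<dots> = \<theta> ^ n * exp (\<kappa> * N) + \<epsilon> * (\<integral>y. exp (\<kappa> * (x - y)) \<partial>\<mu>)"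
          using prob_space by simp
        finally show ?thesis by (simp add: distrib_left mult_ac)
      qed
      also have "\<dots> \<le> \<theta> ^ Suc n * exp (\<kappa> * N) + \<epsilon> * exp (\<kappa> * x)"
        using exp_conv_le[of x] that by (intro add_left_mono mult_left_mono) auto
      finally show ?case .
    qed
    have "(\<lambda>n. \<theta> ^ n * exp (\<kappa> * N) + \<epsilon> * exp (\<kappa> * x)) \<longlonglongrightarrow> 0 * exp (\<kappa> * N) + \<epsilon> * exp (\<kappa> * x)"
      using theta by (intro tendsto_intros LIMSEQ_realpow_zero) auto
    from LIMSEQ_le_const[OF this] it show ?thesis by auto
  qed
  \<comment> \<open>At fixed \<open>x\<close>, rescaling \<open>\<epsilon>\<close> absorbs the
    factor \<open>exp (\<kappa> * x)\<close>.\<close>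
  from this[of "\<epsilon> * exp (- \<kappa> * x)" for \<epsilon>] have "f x \<le> 0 + \<epsilon>" if "\<epsilon> > 0" for \<epsilon>
    using that by (simp add: exp_minus field_simps)
  then have "f x \<le> 0" by (rule field_le_epsilon)
  then show ?thesis using f(1)[of x] by simp
qed

section \<open>The contribution of large jumps\<close>

definition J :: "real \<Rightarrow> real" where
  "J a = (\<integral>w. indicator {..<a} w * h w \<partial>lborel)"

lemma integrable_lborel_le_exp:
  assumes [measurable]: "f \<in> borel_measurable borel" and "\<And>w. 0 \<le> f w" "\<And>w. f w \<le> c * exp (\<kappa> * w)"
  shows "integrable lborel (\<lambda>w. indicator {..<a} w * f w)"
proof -
  have "integrable lborel (\<lambda>w. c * (indicator {..<a} w * exp (\<kappa> * w)))"
    using has_bochner_integral_exp_lessThan[OF kappa] by (intro integrable_mult_right) (auto simp: has_bochner_integral_iff)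
  then show ?thesis
  proof (rule Bochner_Integration.integrable_bound)
    show "AE w in lborel. norm (indicator {..<a} w * f w) \<le> norm (c * (indicator {..<a} w * exp (\<kappa> * w)))"
      using assms(2,3) by (intro AE_I2) (auto simp: indicator_def intro: order_trans[OF _ abs_ge_self])
  qed measurable
qed

text \<open>The truncation makes \<open>h \<le> exp (\<kappa> w)\<close> sufficient, before
  integrability of \<open>h\<close> on the whole line is established.\<close>

lemma J_integrable: "integrable lborel (\<lambda>w. indicator {..<a} w * h w)"
  by (rule integrable_lborel_le_exp[where c = 1]) (auto simp: h_le_exp)

lemma J_nonneg: "J a \<ge> 0"
  unfolding J_def by (intro integral_nonneg_AE) auto

text \<open>Since \<open>h\<close> grows at most by a factor \<open>exp (\<kappa> \<sigma>)\<close> on intervals of length \<open>\<sigma>\<close>, averaging it over such an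
  interval and applying Tonelli transfers the integration from \<open>\<mu>\<close> to Lebesgue measure.\<close>

definition smoothed :: "real \<Rightarrow> real \<Rightarrow> real \<Rightarrow> real \<Rightarrow> real" where
  "smoothed a \<sigma> c x = (\<integral>w. indicator {..<a} w * (h w * local_mass \<sigma> (cdf \<mu>) (x - w - c)) \<partial>lborel)"

lemma local_mass_01: "\<sigma> \<ge> 0 \<Longrightarrow> 0 \<le> local_mass \<sigma> (cdf \<mu>) x \<and> local_mass \<sigma> (cdf \<mu>) x \<le> 1"
  by (simp add: local_mass_cdf)

lemma local_mass_measurable [measurable]: "local_mass \<sigma> (cdf \<mu>) \<in> borel_measurable borel"
  unfolding local_mass_def[abs_def] by measurable

lemma smoothed_integrable:
  assumes "\<sigma> \<ge> 0"
  shows "integrable lborel (\<lambda>w. indicator {..<a} w * (h w * local_mass \<sigma> (cdf \<mu>) (x - w - c)))"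
proof (rule integrable_lborel_le_exp[where c = 1])
  show "h w * local_mass \<sigma> (cdf \<mu>) (x - w - c) \<le> 1 * exp (\<kappa> * w)" for w
    using mult_mono[OF h_le_exp[of w], of "local_mass \<sigma> (cdf \<mu>) (x - w - c)" 1] local_mass_01[OF assms]
    by simp
qed (use local_mass_01[OF assms] in auto)

lemma smoothed_eq:
  assumes "\<sigma> \<ge> 0"
  shows "ennreal (smoothed a \<sigma> c x) =
    (\<integral>\<^sup>+y. (\<integral>\<^sup>+w. ennreal (indicator {..<a} w * h w) * indicator {x - w - c<..x - w - c + \<sigma>} y \<partial>lborel) \<partial>\<mu>)"
proof -
  interpret P: pair_sigma_finite lborel \<mu> ..
  have "ennreal (smoothed a \<sigma> c x) =
      (\<integral>\<^sup>+w. ennreal (indicator {..<a} w * (h w * local_mass \<sigma> (cdf \<mu>) (x - w - c))) \<partial>lborel)"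
    unfolding smoothed_def using local_mass_01[OF assms]
    by (intro nn_integral_eq_integral[symmetric] smoothed_integrable assms AE_I2) auto
  also have "\<dots> = (\<integral>\<^sup>+w. (\<integral>\<^sup>+y. ennreal (indicator {..<a} w * h w) * indicator {x - w - c<..x - w - c + \<sigma>} y \<partial>\<mu>) \<partial>lborel)"
    using assms
    by (intro nn_integral_cong)
       (simp add: nn_integral_cmult emeasure_eq_measure local_mass_cdf ennreal_mult[symmetric] mult.assoc)
  also have "\<dots> = (\<integral>\<^sup>+y. (\<integral>\<^sup>+w. ennreal (indicator {..<a} w * h w) * indicator {x - w - c<..x - w - c + \<sigma>} y \<partial>lborel) \<partial>\<mu>)"
    by (rule P.Fubini'[symmetric]) (simp add: split_beta' indicator_def[of "{_<.._}"])
  finally show ?thesis .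
qed

definition near_end :: "real \<Rightarrow> real \<Rightarrow> real" where
  "near_end a x = (\<integral>y. indicator {x - a<..} y * h (x - y) \<partial>\<mu>)"

lemma near_end_eq: "ennreal (near_end a x) = (\<integral>\<^sup>+y. ennreal (indicator {x - a<..} y * h (x - y)) \<partial>\<mu>)"
  unfolding near_end_def by (intro nn_integral_eq_integral[symmetric] integrable_h_ind) auto

lemma near_end_nonneg: "0 \<le> near_end a x"
  unfolding near_end_def by (intro integral_nonneg_AE) auto

lemma smoothed_nonneg: "\<sigma> \<ge> 0 \<Longrightarrow> 0 \<le> smoothed a \<sigma> c x"
  unfolding smoothed_def using local_mass_01 by (intro integral_nonneg_AE) auto

text \<open>The window of length \<open>\<sigma>\<close> to the left of \<open>x - y\<close> is
  used: there \<open>h (x - y) \<le> exp (\<kappa> * \<sigma>) * h w\<close>, and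
  \<open>w \<le> x - y < a\<close> stays in range. In terms of \<open>y\<close> this window is
  \<open>x - w - \<sigma> < y \<le> x - w\<close>, hence the offset
  \<open>c = \<sigma>\<close>.\<close>

lemma near_end_upper:
  assumes "\<sigma> > 0"
  shows "\<sigma> * near_end a x \<le> exp (\<kappa> * \<sigma>) * smoothed a \<sigma> \<sigma> x"
proof -
  have "ennreal (\<sigma> * near_end a x) = (\<integral>\<^sup>+y. ennreal (indicator {x - a<..} y * h (x - y)) * \<sigma> \<partial>\<mu>)"
  proof -
    have "ennreal (\<sigma> * near_end a x) = ennreal (near_end a x) * ennreal \<sigma>"
      using assms near_end_nonneg by (simp add: ennreal_mult mult.commute)
    also have "\<dots> = (\<integral>\<^sup>+y. ennreal (indicator {x - a<..} y * h (x - y)) * \<sigma> \<partial>\<mu>)"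
      unfolding near_end_eq by (rule nn_integral_multc[symmetric]) measurable
    finally show ?thesis .
  qed
  also have "\<dots> \<le> (\<integral>\<^sup>+y. ennreal (exp (\<kappa> * \<sigma>)) *
      (\<integral>\<^sup>+w. ennreal (indicator {..<a} w * h w) * indicator {x - w - \<sigma><..x - w - \<sigma> + \<sigma>} y \<partial>lborel) \<partial>\<mu>)"
  proof (intro nn_integral_mono)
    fix y
    have "ennreal (indicator {x - a<..} y * h (x - y)) * \<sigma> =
        (\<integral>\<^sup>+w. ennreal (indicator {x - a<..} y * h (x - y)) * indicator {x - y - \<sigma><..x - y} w \<partial>lborel)"
      using assms by (simp add: nn_integral_cmult)
    also have "\<dots> \<le> (\<integral>\<^sup>+w. ennreal (exp (\<kappa> * \<sigma>)) *
        (ennreal (indicator {..<a} w * h w) * indicator {x - w - \<sigma><..x - w - \<sigma> + \<sigma>} y) \<partial>lborel)"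
    proof (intro nn_integral_mono)
      fix w
      show "ennreal (indicator {x - a<..} y * h (x - y)) * indicator {x - y - \<sigma><..x - y} w \<le>
         ennreal (exp (\<kappa> * \<sigma>)) * (ennreal (indicator {..<a} w * h w) * indicator {x - w - \<sigma><..x - w - \<sigma> + \<sigma>} y)"
      proof (cases "y > x - a \<and> x - y - \<sigma> < w \<and> w \<le> x - y")
        case True
        have "h (x - y) \<le> exp (\<kappa> * (x - y - w)) * h w" using True by (intro h_growth) auto
        also have "\<dots> \<le> exp (\<kappa> * \<sigma>) * h w" using True kappa by (intro mult_right_mono) auto
        finally show ?thesis using True by (simp add: indicator_def ennreal_mult[symmetric])
      qed (auto simp: indicator_def)
    qed
    also have "\<dots> = ennreal (exp (\<kappa> * \<sigma>)) *
      (\<integral>\<^sup>+w. ennreal (indicator {..<a} w * h w) * indicator {x - w - \<sigma><..x - w - \<sigma> + \<sigma>} y \<partial>lborel)"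
      by (rule nn_integral_cmult) (simp add: indicator_def[of "{_<.._}"])
    finally show "ennreal (indicator {x - a<..} y * h (x - y)) * \<sigma> \<le> \<dots>" .
  qed
  also have "\<dots> = ennreal (exp (\<kappa> * \<sigma>)) * ennreal (smoothed a \<sigma> \<sigma> x)"
    using assms by (subst smoothed_eq) (auto simp: nn_integral_cmult indicator_def[of "{_<.._}"] intro!: nn_integral_cmult)
  also have "\<dots> = ennreal (exp (\<kappa> * \<sigma>) * smoothed a \<sigma> \<sigma> x)"
    using assms by (simp add: ennreal_mult smoothed_nonneg)
  finally show ?thesis
    using assms smoothed_nonneg[of \<sigma> a \<sigma> x] by (subst (asm) ennreal_le_iff) auto
qed

text \<open>Mirror image with the window to the right of \<open>x - y\<close>: there
  \<open>h w \<le> exp (\<kappa> * \<sigma>) * h (x - y)\<close>, and \<open>w < a\<close> forces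
  \<open>x - y < a\<close>. The window reads \<open>x - w < y \<le> x - w + \<sigma>\<close>, hence
  the offset \<open>0\<close>.\<close>

lemma near_end_lower:
  assumes "\<sigma> > 0"
  shows "smoothed a \<sigma> 0 x \<le> exp (\<kappa> * \<sigma>) * (\<sigma> * near_end a x)"
proof -
  have "ennreal (smoothed a \<sigma> 0 x) =
      (\<integral>\<^sup>+y. (\<integral>\<^sup>+w. ennreal (indicator {..<a} w * h w) * indicator {x - w - 0<..x - w - 0 + \<sigma>} y \<partial>lborel) \<partial>\<mu>)"
    using assms by (intro smoothed_eq) auto
  also have "\<dots> \<le> (\<integral>\<^sup>+y. ennreal (exp (\<kappa> * \<sigma>) * \<sigma>) * ennreal (indicator {x - a<..} y * h (x - y)) \<partial>\<mu>)"
  proof (intro nn_integral_mono)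
    fix y
    have "(\<integral>\<^sup>+w. ennreal (indicator {..<a} w * h w) * indicator {x - w - 0<..x - w - 0 + \<sigma>} y \<partial>lborel) \<le>
      (\<integral>\<^sup>+w. ennreal (exp (\<kappa> * \<sigma>) * (indicator {x - a<..} y * h (x - y))) * indicator {x - y<..x - y + \<sigma>} w \<partial>lborel)"
    proof (intro nn_integral_mono)
      fix w
      show "ennreal (indicator {..<a} w * h w) * indicator {x - w - 0<..x - w - 0 + \<sigma>} y \<le>
        ennreal (exp (\<kappa> * \<sigma>) * (indicator {x - a<..} y * h (x - y))) * indicator {x - y<..x - y + \<sigma>} w"
      proof (cases "w < a \<and> x - y < w \<and> w \<le> x - y + \<sigma>")
        case True
        have "h w \<le> exp (\<kappa> * (w - (x - y))) * h (x - y)" using True by (intro h_growth) auto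
        also have "\<dots> \<le> exp (\<kappa> * \<sigma>) * h (x - y)" using True kappa by (intro mult_right_mono) auto
        finally show ?thesis using True by (simp add: indicator_def ennreal_leI)
      qed (auto simp: indicator_def)
    qed
    also have "\<dots> = ennreal (exp (\<kappa> * \<sigma>) * (indicator {x - a<..} y * h (x - y))) * ennreal \<sigma>"
      using assms by (simp add: nn_integral_cmult)
    also have "\<dots> = ennreal (exp (\<kappa> * \<sigma>) * \<sigma>) * ennreal (indicator {x - a<..} y * h (x - y))"
      using assms by (simp add: ennreal_mult[symmetric] mult_ac)
    finally show "(\<integral>\<^sup>+w. ennreal (indicator {..<a} w * h w) * indicator {x - w - 0<..x - w - 0 + \<sigma>} y \<partial>lborel) \<le> \<dots>" .
  qed
  also have "\<dots> = ennreal (exp (\<kappa> * \<sigma>) * (\<sigma> * near_end a x))"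
  proof -
    have "ennreal (exp (\<kappa> * \<sigma>) * (\<sigma> * near_end a x)) = ennreal (exp (\<kappa> * \<sigma>) * \<sigma>) * ennreal (near_end a x)"
      using assms near_end_nonneg by (simp add: ennreal_mult[symmetric] mult.assoc)
    also have "\<dots> = (\<integral>\<^sup>+y. ennreal (exp (\<kappa> * \<sigma>) * \<sigma>) * ennreal (indicator {x - a<..} y * h (x - y)) \<partial>\<mu>)"
      unfolding near_end_eq by (rule nn_integral_cmult[symmetric]) measurable
    finally show ?thesis by simp
  qed
  finally show ?thesis
    using assms near_end_nonneg by (subst (asm) ennreal_le_iff) auto
qed

text \<open>Dominated convergence in \<open>w\<close>: the mass of a window of length
  \<open>1/m\<close> near \<open>x - w - c\<close> is asymptotically \<open>g x / m\<close> for
  every fixed \<open>w\<close> and \<open>c\<close>.\<close>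

lemma smoothed_asymp:
  assumes m: "m > 0" and c: "c \<ge> 0"
  shows "((\<lambda>x. smoothed a (1 / real m) c x / g x) \<longlongrightarrow> 1 / real m * J a) at_top"
proof -
  let ?l = "local_mass (1 / real m) (cdf \<mu>)"
  obtain K x0 where K: "K > 0" "\<And>x. x \<ge> x0 \<Longrightarrow> g x > 0"
      "\<And>x y. x0 \<le> x \<Longrightarrow> x \<le> y \<Longrightarrow> g y \<le> K * g x"
    by (rule g_dominates) blast
  have l_le: "?l x \<le> g x" for x
  proof -
    have "1 / real m \<le> 1" using m by simp
    then show ?thesis by (auto simp: local_mass_cdf g_eq intro!: finite_measure_mono)
  qed
  have l_nn: "0 \<le> ?l x" for x using local_mass_01[of "1 / real m"] by simp
  have "((\<lambda>x. \<integral>w. indicator {..<a} w * h w * (?l (x - w - c) / g x) \<partial>lborel)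
      \<longlongrightarrow> (\<integral>w. indicator {..<a} w * h w * (1 / real m) \<partial>lborel)) at_top"
  proof (rule integral_dominated_convergence_at_top[where w = "\<lambda>w. indicator {..<a} w * h w * (K * 2)"])
    show "integrable lborel (\<lambda>w. indicator {..<a} w * h w * (K * 2))"
      by (intro integrable_mult_left J_integrable)
    show "AE w in lborel. ((\<lambda>x. indicator {..<a} w * h w * (?l (x - w - c) / g x))
        \<longlongrightarrow> indicator {..<a} w * h w * (1 / real m)) at_top"
    proof (intro AE_I2 tendsto_mult tendsto_const)
      fix w
      have 1: "((\<lambda>x. ?l (x - w - c) / g (x - w - c)) \<longlongrightarrow> 1 / real m) at_top"
        by (rule filterlim_compose[OF local_mass_ratio[OF m]]) real_asymp
      have 2: "((\<lambda>x. g (x + (- w - c)) / g x) \<longlongrightarrow> 1) at_top" by (rule g_shift)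
      have "eventually (\<lambda>x. g (x - w - c) > 0) at_top"
        by (rule eventually_compose_filterlim[OF g_pos]) real_asymp
      then have "eventually (\<lambda>x. ?l (x - w - c) / g (x - w - c) * (g (x + (- w - c)) / g x) = ?l (x - w - c) / g x) at_top"
        by eventually_elim (simp add: algebra_simps)
      from Lim_transform_eventually[OF tendsto_mult[OF 1 2] this]
      show "((\<lambda>x. ?l (x - w - c) / g x) \<longlongrightarrow> 1 / real m) at_top" by simp
    qed
    have "eventually (\<lambda>x. g (x + (- a - c)) / g x < 2) at_top"
      by (intro order_tendstoD(2)[OF g_shift]) auto
    moreover have "eventually (\<lambda>x. x \<ge> x0 + \<bar>a\<bar> + c) at_top" by (rule eventually_ge_at_top)
    ultimately show "\<forall>\<^sub>F x in at_top. AE w in lborel.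
        norm (indicator {..<a} w * h w * (?l (x - w - c) / g x)) \<le> indicator {..<a} w * h w * (K * 2)"
    proof eventually_elim
      case (elim x)
      have gp: "g x > 0" using elim K c by auto
      \<comment> \<open>For \<open>w < a\<close> the argument lies to the right of
        \<open>x - a - c\<close>, where almost monotonicity and one fixed shift bound
        \<open>g\<close>; this makes the majorant uniform in \<open>w\<close>.\<close>
      have "?l (x - w - c) / g x \<le> K * 2" if "w < a" for w
      proof -
        have "?l (x - w - c) \<le> g (x - w - c)" by (rule l_le)
        also have "\<dots> \<le> K * g (x + (- a - c))" using K(3)[of "x + (- a - c)" "x - w - c"] that elim by auto
        also have "\<dots> \<le> K * (2 * g x)"
          using elim gp K(1) by (intro mult_left_mono) (auto simp: pos_divide_less_eq)
        finally show ?thesis using gp by (simp add: field_simps)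
      qed
      then have "h w * (?l (x - w - c) / g x) \<le> h w * (K * 2)" if "w < a" for w
        using that by (intro mult_left_mono) auto
      then show ?case
        using gp l_nn by (intro AE_I2) (auto simp: indicator_def abs_mult)
    qed
  qed measurable
  moreover have "(\<lambda>x. \<integral>w. indicator {..<a} w * h w * (?l (x - w - c) / g x) \<partial>lborel) =
      (\<lambda>x. smoothed a (1 / real m) c x / g x)"
    unfolding smoothed_def integral_divide_zero[symmetric]
    by (intro ext Bochner_Integration.integral_cong) (simp_all add: mult.assoc)
  ultimately show ?thesis by (simp add: J_def)
qed

text \<open>The two window estimates enclose \<open>near_end a x / g x\<close> asymptotically
  between \<open>J a\<close> times \<open>exp (- \<kappa> / m)\<close> and \<open>J a\<close> times
  \<open>exp (\<kappa> / m)\<close>. For a given threshold \<open>b\<close>, \<open>m\<close> is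
  fixed first and \<open>x\<close> goes to infinity afterwards.\<close>

lemma near_end_asymp: "((\<lambda>x. near_end a x / g x) \<longlongrightarrow> J a) at_top"
proof -
  have "((\<lambda>s. exp (\<kappa> * (1 / s))) \<longlongrightarrow> 1) at_top" by real_asymp
  from tendsto_mult_right[OF this, of "J a"]
  have lim1: "((\<lambda>s. exp (\<kappa> * (1 / s)) * J a) \<longlongrightarrow> J a) at_top" by simp
  have "((\<lambda>s. exp (- (\<kappa> * (1 / s)))) \<longlongrightarrow> 1) at_top" by real_asymp
  from tendsto_mult_right[OF this, of "J a"]
  have lim2: "((\<lambda>s. exp (- (\<kappa> * (1 / s))) * J a) \<longlongrightarrow> J a) at_top" by simp
  note seq = filterlim_compose[OF _ filterlim_real_sequentially]
  show ?thesis
  proof (rule order_tendstoI)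
    fix b assume "b < J a"
    then have "eventually (\<lambda>n. exp (- (\<kappa> * (1 / real n))) * J a > b) sequentially"
      by (rule order_tendstoD(1)[OF seq[OF lim2]])
    from eventually_happens'[OF sequentially_bot eventually_conj[OF eventually_gt_at_top[of 0] this]]
    obtain m :: nat where m: "m > 0" "exp (- (\<kappa> * (1 / real m))) * J a > b" by blast
    have "((\<lambda>x. exp (- (\<kappa> * (1 / real m))) * real m * (smoothed a (1 / real m) 0 x / g x)) \<longlongrightarrow>
        exp (- (\<kappa> * (1 / real m))) * real m * (1 / real m * J a)) at_top"
      using m by (intro tendsto_mult tendsto_const smoothed_asymp) auto
    then have "eventually (\<lambda>x. exp (- (\<kappa> * (1 / real m))) * real m * (smoothed a (1 / real m) 0 x / g x) > b) at_top"
      by (rule order_tendstoD) (use m in simp)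
    then show "eventually (\<lambda>x. b < near_end a x / g x) at_top" using g_pos
    proof eventually_elim
      case (elim x)
      have "exp (- (\<kappa> * (1 / real m))) * real m * smoothed a (1 / real m) 0 x \<le> near_end a x"
        using near_end_lower[of "1 / real m" a x] m by (simp add: exp_minus field_simps)
      from divide_right_mono[OF this, of "g x"] show ?case using elim by simp
    qed
  next
    fix b assume "b > J a"
    then have "eventually (\<lambda>n. exp (\<kappa> * (1 / real n)) * J a < b) sequentially"
      by (rule order_tendstoD(2)[OF seq[OF lim1]])
    from eventually_happens'[OF sequentially_bot eventually_conj[OF eventually_gt_at_top[of 0] this]]
    obtain m :: nat where m: "m > 0" "exp (\<kappa> * (1 / real m)) * J a < b" by blast
    have "((\<lambda>x. exp (\<kappa> * (1 / real m)) * real m * (smoothed a (1 / real m) (1 / real m) x / g x)) \<longlongrightarrow>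
        exp (\<kappa> * (1 / real m)) * real m * (1 / real m * J a)) at_top"
      using m by (intro tendsto_mult tendsto_const smoothed_asymp) auto
    then have "eventually (\<lambda>x. exp (\<kappa> * (1 / real m)) * real m * (smoothed a (1 / real m) (1 / real m) x / g x) < b) at_top"
      by (rule order_tendstoD) (use m in simp)
    then show "eventually (\<lambda>x. near_end a x / g x < b) at_top" using g_pos
    proof eventually_elim
      case (elim x)
      have "near_end a x \<le> exp (\<kappa> * (1 / real m)) * real m * smoothed a (1 / real m) (1 / real m) x"
        using near_end_upper[of "1 / real m" a x] m by (simp add: field_simps)
      from divide_right_mono[OF this, of "g x"] show ?case using elim by simp
    qed
  qed
qed

section \<open>Boundedness of \<open>h / g\<close>\<close>

definition far :: "real \<Rightarrow> real \<Rightarrow> real" where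
  "far a x = (\<integral>y. indicator {..x - a} y * h (x - y) \<partial>\<mu>)"

lemma renewal_split: "h x = \<psi> x + \<theta> * (near_end a x + far a x)"
proof -
  have "(\<integral>y. h (x - y) \<partial>\<mu>) = (\<integral>y. indicator {x - a<..} y * h (x - y) + indicator {..x - a} y * h (x - y) \<partial>\<mu>)"
    by (intro Bochner_Integration.integral_cong) (auto simp: indicator_def)
  also have "\<dots> = near_end a x + far a x"
    unfolding near_end_def far_def by (intro Bochner_Integration.integral_add integrable_h_ind) auto
  finally show ?thesis by (subst renewal_h) simp
qed

lemma psi_negligible: "((\<lambda>x. \<psi> x / g x) \<longlongrightarrow> 0) at_top"
proof -
  have lim: "((\<lambda>x. C0 * (exp (- \<delta> * x) / g x)) \<longlongrightarrow> 0) at_top"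
    by (rule tendsto_mult_right_zero) (rule exp_negligible[OF delta])
  have le: "eventually (\<lambda>x. \<psi> x / g x \<le> C0 * (exp (- \<delta> * x) / g x)) at_top"
    using eventually_ge_at_top[of 0] by eventually_elim (use divide_right_mono[OF psi_bound g_nonneg] in simp)
  show ?thesis
    by (rule tendsto_sandwich[OF _ le tendsto_const lim]) (simp add: psi_nonneg)
qed

text \<open>For large \<open>C\<close>, \<open>C * g\<close> is a supersolution far out. The excess
  of \<open>h\<close> over it is then a subsolution of the homogeneous equation dominated by
  \<open>h\<close>, hence zero by \<open>subsolution_eq_0\<close>.\<close>

lemma h_bound:
  obtains C where "C > 0" "eventually (\<lambda>x. h x \<le> C * g x) at_top"
proof -
  obtain K x0 where K: "K > 0" "\<And>x. x \<ge> x0 \<Longrightarrow> g x > 0"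
      "\<And>x y. x0 \<le> x \<Longrightarrow> x \<le> y \<Longrightarrow> g y \<le> K * g x"
    by (rule g_dominates) blast
  \<comment> \<open>Makes \<open>\<theta> * (1 + \<epsilon>)\<close> the midpoint of
    \<open>\<theta>\<close> and \<open>1\<close>, so the truncated convolution still
    contracts.\<close>
  define \<epsilon> where "\<epsilon> = (1 - \<theta>) / (2 * \<theta>)"
  have eps: "\<epsilon> > 0" "\<theta> * (1 + \<epsilon>) = (1 + \<theta>) / 2"
    using theta by (auto simp: \<epsilon>_def field_simps)
  from eventually_happens'[OF trivial_limit_at_top_linorder eventually_conj[OF truncated_conv_le[OF eps(1)] eventually_ge_at_top[of x0]]]
  obtain a where a: "a \<ge> x0" and
      tr: "eventually (\<lambda>x. (\<integral>y. indicator {..x - a} y * g (x - y) \<partial>\<mu>) \<le> (1 + \<epsilon>) * g x) at_top"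
    by blast
  have "eventually (\<lambda>x. near_end a x / g x < J a + 1) at_top"
    by (intro order_tendstoD(2)[OF near_end_asymp]) simp
  moreover have "eventually (\<lambda>x. \<psi> x / g x < 1) at_top"
    by (intro order_tendstoD(2)[OF psi_negligible]) simp
  ultimately have "eventually (\<lambda>x. x \<ge> a \<and> near_end a x \<le> (J a + 1) * g x \<and> \<psi> x \<le> g x \<and>
      (\<integral>y. indicator {..x - a} y * g (x - y) \<partial>\<mu>) \<le> (1 + \<epsilon>) * g x) at_top"
    using tr g_pos eventually_ge_at_top[of a]
    by eventually_elim (auto simp: pos_divide_less_eq)
  then obtain x2 where x2: "x2 \<ge> a" "\<And>x. x \<ge> x2 \<Longrightarrow> near_end a x \<le> (J a + 1) * g x"
      "\<And>x. x \<ge> x2 \<Longrightarrow> \<psi> x \<le> g x"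
      "\<And>x. x \<ge> x2 \<Longrightarrow> (\<integral>y. indicator {..x - a} y * g (x - y) \<partial>\<mu>) \<le> (1 + \<epsilon>) * g x"
    by (auto simp: eventually_at_top_linorder)
  \<comment> \<open>The first entry gives \<open>h \<le> C * g\<close> on \<open>[a, x2]\<close>.
    The second absorbs \<open>\<psi>\<close> and the near end, which together cost at most
    \<open>1 + \<theta> * (J a + 1)\<close> times \<open>g\<close>, into the gap
    \<open>C * (1 - \<theta>) / 2\<close>.\<close>
  define C where "C = max (exp (\<kappa> * x2) * K / g x2) ((1 + \<theta> * (J a + 1)) * 2 / (1 - \<theta>))"
  have Cpos: "C > 0"
    using theta J_nonneg[of a] by (auto simp: C_def less_max_iff_disj intro!: divide_pos_pos add_pos_nonneg)
  have C1: "1 + \<theta> * (J a + 1) + C * (\<theta> * (1 + \<epsilon>)) \<le> C"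
  proof -
    have "(1 + \<theta> * (J a + 1)) * 2 / (1 - \<theta>) \<le> C" by (simp add: C_def)
    then have "(1 + \<theta> * (J a + 1)) * 2 \<le> C * (1 - \<theta>)" using theta by (simp add: pos_divide_le_eq)
    then show ?thesis by (simp add: eps field_simps)
  qed
  have C2: "h x \<le> C * g x" if "a \<le> x" "x \<le> x2" for x
  proof -
    have gx: "g x2 > 0" using K(2)[of x2] x2 a by auto
    have "h x \<le> exp (\<kappa> * x)" by (rule h_le_exp)
    also have "\<dots> \<le> exp (\<kappa> * x2)" using that kappa by simp
    also have "\<dots> = exp (\<kappa> * x2) * K / g x2 * (g x2 / K)" using K gx by simp
    also have "\<dots> \<le> C * (g x2 / K)" using K by (intro mult_right_mono) (auto simp: C_def)
    also have "\<dots> \<le> C * g x" using K(1) K(3)[of x x2] that a Cpos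
      by (intro mult_left_mono) (auto simp: field_simps)
    finally show ?thesis .
  qed
  \<comment> \<open>The excess is cut off at \<open>x2\<close>: on \<open>[a, x2]\<close> it is zero
    anyway, and values of \<open>h\<close> below \<open>a\<close> are accounted for by
    \<open>near_end\<close>. So \<open>h \<le> C * g + f\<close> holds at all arguments met by
    \<open>far\<close>.\<close>
  define f where "f x = (if x < x2 then 0 else max 0 (h x - C * g x))" for x
  have f_meas [measurable]: "f \<in> borel_measurable borel" unfolding f_def by measurable
  have f_nn: "0 \<le> f x" and f_le: "f x \<le> h x" for x
    using mult_nonneg_nonneg[OF less_imp_le[OF Cpos] g_nonneg[of x]] h_nonneg[of x] by (auto simp: f_def)
  have h_le: "h z \<le> C * g z + f z" if "z \<ge> a" for z
    using C2[of z] that by (auto simp: f_def not_less)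
  have sub: "f x \<le> \<theta> * (\<integral>y. f (x - y) \<partial>\<mu>)" for x
  proof (cases "x < x2 \<or> h x \<le> C * g x")
    case True
    then have "f x = 0" by (auto simp: f_def)
    then show ?thesis using theta f_nn by (auto intro!: integral_nonneg_AE)
  next
    case False
    then have x: "x \<ge> x2" and fx: "f x = h x - C * g x" by (auto simp: f_def)
    have "far a x \<le> (\<integral>y. C * (indicator {..x - a} y * g (x - y)) + f (x - y) \<partial>\<mu>)"
      unfolding far_def
    proof (intro integral_mono integrable_h_ind Bochner_Integration.integrable_add integrable_mult_right
        integrable_g_conv_ind integrable_conv_le_h f_nn f_le)
      fix y
      show "indicator {..x - a} y * h (x - y) \<le> C * (indicator {..x - a} y * g (x - y)) + f (x - y)"
        using h_le[of "x - y"] f_nn by (auto simp: indicator_def)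
    qed auto
    also have "\<dots> = C * (\<integral>y. indicator {..x - a} y * g (x - y) \<partial>\<mu>) + (\<integral>y. f (x - y) \<partial>\<mu>)"
      by (subst Bochner_Integration.integral_add)
         (auto intro!: integrable_mult_right integrable_g_conv_ind integrable_conv_le_h f_nn f_le)
    also have "\<dots> \<le> C * ((1 + \<epsilon>) * g x) + (\<integral>y. f (x - y) \<partial>\<mu>)"
      using x2(4)[OF x] Cpos by simp
    finally have far: "far a x \<le> C * ((1 + \<epsilon>) * g x) + (\<integral>y. f (x - y) \<partial>\<mu>)" .
    have "h x \<le> g x + \<theta> * ((J a + 1) * g x + (C * ((1 + \<epsilon>) * g x) + (\<integral>y. f (x - y) \<partial>\<mu>)))"
      unfolding renewal_split[of x a] using x2(2,3)[OF x] far theta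
      by (intro add_mono mult_left_mono) auto
    also have "\<dots> = (1 + \<theta> * (J a + 1) + C * (\<theta> * (1 + \<epsilon>))) * g x + \<theta> * (\<integral>y. f (x - y) \<partial>\<mu>)"
      by (simp add: algebra_simps)
    also have "\<dots> \<le> C * g x + \<theta> * (\<integral>y. f (x - y) \<partial>\<mu>)"
      using C1 by (intro add_right_mono mult_right_mono) auto
    finally show ?thesis by (simp add: fx)
  qed
  have "f x = 0" for x by (rule subsolution_eq_0[OF f_meas f_nn f_le sub])
  then have "h x \<le> C * g x" if "x \<ge> x2" for x using that h_le[of x] x2(1) by auto
  then show thesis using that[OF Cpos] by (auto simp: eventually_at_top_linorder)
qed

section \<open>The integrals of \<open>h\<close> and \<open>\<psi>\<close>\<close>

lemma integrable_g: "integrable lborel g"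
proof (rule integrableI_nonneg)
  interpret P: pair_sigma_finite lborel \<mu> ..
  have "(\<integral>\<^sup>+x. ennreal (g x) \<partial>lborel) = (\<integral>\<^sup>+x. (\<integral>\<^sup>+y. indicator {x<..x + 1} y \<partial>\<mu>) \<partial>lborel)"
    by (intro nn_integral_cong) (simp add: g_eq emeasure_eq_measure)
  also have "\<dots> = (\<integral>\<^sup>+y. (\<integral>\<^sup>+x. indicator {x<..x + 1} y \<partial>lborel) \<partial>\<mu>)"
    by (rule P.Fubini'[symmetric]) (simp add: indicator_def split_beta')
  \<comment> \<open>A fixed \<open>y\<close> lies in \<open>(x, x + 1]\<close> for a set of
    \<open>x\<close> of length one.\<close>
  also have "\<dots> = (\<integral>\<^sup>+y. (\<integral>\<^sup>+x. indicator {y - 1..<y} x \<partial>lborel) \<partial>\<mu>)"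
    by (intro nn_integral_cong) (auto simp: indicator_def)
  also have "\<dots> = 1" using emeasure_space_1 by simp
  finally show "(\<integral>\<^sup>+x. ennreal (g x) \<partial>lborel) < \<infinity>" by simp
qed auto

text \<open>The exponential bound handles the left half-line, the comparison with the integrable
  \<open>g\<close> the right one.\<close>

lemma integrable_h: "integrable lborel h"
proof -
  obtain C where C: "C > 0" "eventually (\<lambda>x. h x \<le> C * g x) at_top" by (rule h_bound) blast
  then obtain a where a: "\<And>x. x \<ge> a \<Longrightarrow> h x \<le> C * g x" by (auto simp: eventually_at_top_linorder)
  have "integrable lborel (\<lambda>x. indicator {..<a} x * h x + C * g x)"
    by (intro Bochner_Integration.integrable_add J_integrable integrable_mult_right integrable_g)
  then show ?thesis
  proof (rule Bochner_Integration.integrable_bound)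
    show "AE x in lborel. norm (h x) \<le> norm (indicator {..<a} x * h x + C * g x)"
      using a C by (intro AE_I2) (auto simp: indicator_def not_less intro: order_trans)
  qed measurable
qed

lemma psi_le_h: "\<psi> x \<le> h x"
proof -
  have "0 \<le> (\<integral>y. h (x - y) \<partial>\<mu>)" by (intro integral_nonneg_AE) auto
  then show ?thesis using renewal_h[of x] theta by simp
qed

lemma integrable_psi: "integrable lborel \<psi>"
  by (rule Bochner_Integration.integrable_bound[OF integrable_h]) (auto simp: psi_le_h psi_nonneg)

text \<open>The renewal equation is integrated over the line: convolution with a probability measure
  preserves the Lebesgue integral.\<close>

lemma integral_h: "(1 - \<theta>) * (\<integral>x. h x \<partial>lborel) = (\<integral>x. \<psi> x \<partial>lborel)"
proof -
  interpret P: pair_sigma_finite lborel \<mu> ..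
  have int: "integrable \<mu> (\<lambda>y. h (x - y))" for x
    by (rule integrable_conv_le_h) auto
  have "ennreal (\<integral>x. h x \<partial>lborel) = (\<integral>\<^sup>+x. ennreal (h x) \<partial>lborel)"
    by (intro nn_integral_eq_integral[symmetric] integrable_h) auto
  also have "\<dots> = (\<integral>\<^sup>+x. ennreal (\<psi> x) + ennreal \<theta> * (\<integral>\<^sup>+y. ennreal (h (x - y)) \<partial>\<mu>) \<partial>lborel)"
  proof (intro nn_integral_cong)
    fix x
    have "(\<integral>\<^sup>+y. ennreal (h (x - y)) \<partial>\<mu>) = ennreal (\<integral>y. h (x - y) \<partial>\<mu>)"
      by (intro nn_integral_eq_integral int) auto
    then show "ennreal (h x) = ennreal (\<psi> x) + ennreal \<theta> * (\<integral>\<^sup>+y. ennreal (h (x - y)) \<partial>\<mu>)"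
      using theta psi_nonneg by (subst renewal_h) (simp add: ennreal_mult integral_nonneg_AE)
  qed
  also have "\<dots> = (\<integral>\<^sup>+x. ennreal (\<psi> x) \<partial>lborel) + ennreal \<theta> * (\<integral>\<^sup>+x. (\<integral>\<^sup>+y. ennreal (h (x - y)) \<partial>\<mu>) \<partial>lborel)"
    by (subst nn_integral_add) (auto simp: nn_integral_cmult)
  also have "(\<integral>\<^sup>+x. (\<integral>\<^sup>+y. ennreal (h (x - y)) \<partial>\<mu>) \<partial>lborel) = (\<integral>\<^sup>+y. (\<integral>\<^sup>+x. ennreal (h (x - y)) \<partial>lborel) \<partial>\<mu>)"
    by (rule P.Fubini'[symmetric]) simp
  also have "\<dots> = (\<integral>\<^sup>+y. (\<integral>\<^sup>+x. ennreal (h x) \<partial>lborel) \<partial>\<mu>)"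
  proof (rule nn_integral_cong)
    fix y
    show "(\<integral>\<^sup>+x. ennreal (h (x - y)) \<partial>lborel) = (\<integral>\<^sup>+x. ennreal (h x) \<partial>lborel)"
      by (subst nn_integral_real_affine[where c = 1 and t = "- y", of "\<lambda>x. ennreal (h x)"]) auto
  qed
  also have "\<dots> = ennreal (\<integral>x. h x \<partial>lborel)"
    using emeasure_space_1 by (simp add: nn_integral_eq_integral integrable_h)
  also have "(\<integral>\<^sup>+x. ennreal (\<psi> x) \<partial>lborel) = ennreal (\<integral>x. \<psi> x \<partial>lborel)"
    by (intro nn_integral_eq_integral integrable_psi) (auto simp: psi_nonneg)
  finally have "ennreal (\<integral>x. h x \<partial>lborel) = ennreal ((\<integral>x. \<psi> x \<partial>lborel) + \<theta> * (\<integral>x. h x \<partial>lborel))"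
    using theta psi_nonneg by (simp add: ennreal_mult integral_nonneg_AE)
  \<comment> \<open>Integrability of \<open>h\<close> and \<open>\<psi>\<close> lets the identity
    descend to the reals, where \<open>\<theta>\<close> times the integral of \<open>h\<close> can
    be moved across.\<close>
  then have "(\<integral>x. h x \<partial>lborel) = (\<integral>x. \<psi> x \<partial>lborel) + \<theta> * (\<integral>x. h x \<partial>lborel)"
    using theta psi_nonneg by (subst (asm) ennreal_inj) (auto intro!: integral_nonneg_AE add_nonneg_nonneg mult_nonneg_nonneg)
  then show ?thesis by (simp add: algebra_simps)
qed

section \<open>Asymptotic upper and lower bounds for \<open>h / g\<close> and their
  improvement\<close>

lemma J_le: "J a \<le> (\<integral>x. h x \<partial>lborel)"
  unfolding J_def by (intro integral_mono J_integrable integrable_h) (auto simp: indicator_def)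

lemma J_lim: "(J \<longlongrightarrow> (\<integral>x. h x \<partial>lborel)) at_top"
  unfolding J_def[abs_def]
proof (rule integral_dominated_convergence_at_top[where w = h])
  show "AE x in lborel. ((\<lambda>a. indicator {..<a} x * h x) \<longlongrightarrow> h x) at_top"
  proof (intro AE_I2)
    fix x
    have "eventually (\<lambda>a. h x = indicator {..<a} x * h x) at_top"
      using eventually_gt_at_top[of x] by eventually_elim simp
    then show "((\<lambda>a. indicator {..<a} x * h x) \<longlongrightarrow> h x) at_top"
      by (rule Lim_transform_eventually[OF tendsto_const])
  qed
qed (auto simp: integrable_h indicator_def)

text \<open>One pass through the renewal equation: \<open>\<psi>\<close> is negligible, the near end
  contributes at most the full integral of \<open>h\<close>, and the known bound enters the far
  part. Up to \<open>\<epsilon>\<close>, a constant \<open>c\<close> is replaced by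
  \<open>\<theta>\<close> times that integral plus \<open>c\<close>.\<close>

lemma improve_upper:
  assumes c: "c \<ge> 0" and ev: "eventually (\<lambda>x. h x \<le> c * g x) at_top" and eps: "\<epsilon> > 0"
  shows "eventually (\<lambda>x. h x \<le> (\<epsilon> + \<theta> * ((\<integral>x. h x \<partial>lborel) + \<epsilon> + c * (1 + \<epsilon>))) * g x) at_top"
proof -
  obtain x0 where x0: "\<And>x. x \<ge> x0 \<Longrightarrow> h x \<le> c * g x"
    using ev by (auto simp: eventually_at_top_linorder)
  \<comment> \<open>With \<open>a \<ge> x0\<close> the assumed bound applies to every argument
    \<open>x - y \<ge> a\<close> in the far part.\<close>
  from eventually_happens'[OF trivial_limit_at_top_linorder eventually_conj[OF truncated_conv_le[OF eps] eventually_ge_at_top[of x0]]]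
  obtain a where a: "a \<ge> x0" and
      tr: "eventually (\<lambda>x. (\<integral>y. indicator {..x - a} y * g (x - y) \<partial>\<mu>) \<le> (1 + \<epsilon>) * g x) at_top"
    by blast
  have "eventually (\<lambda>x. near_end a x / g x < (\<integral>x. h x \<partial>lborel) + \<epsilon>) at_top"
    using J_le[of a] eps by (intro order_tendstoD(2)[OF near_end_asymp]) simp
  moreover have "eventually (\<lambda>x. \<psi> x / g x < \<epsilon>) at_top"
    by (intro order_tendstoD(2)[OF psi_negligible] eps)
  ultimately show ?thesis using tr g_pos
  proof eventually_elim
    case (elim x)
    have "far a x \<le> (\<integral>y. c * (indicator {..x - a} y * g (x - y)) \<partial>\<mu>)"
      unfolding far_def
      by (intro integral_mono integrable_h_ind integrable_mult_right integrable_g_conv_ind)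
         (use x0 a in \<open>auto simp: indicator_def\<close>)
    also have "\<dots> \<le> c * ((1 + \<epsilon>) * g x)" using elim c by (simp add: mult_left_mono)
    finally have far: "far a x \<le> c * ((1 + \<epsilon>) * g x)" .
    have "h x \<le> \<epsilon> * g x + \<theta> * (((\<integral>x. h x \<partial>lborel) + \<epsilon>) * g x + c * ((1 + \<epsilon>) * g x))"
      unfolding renewal_split[of x a] using elim far theta
      by (intro add_mono mult_left_mono) (auto simp: pos_divide_less_eq)
    then show ?case by (simp add: algebra_simps)
  qed
qed

text \<open>The same pass from below. Here \<open>a\<close> must also be so large that
  \<open>J a\<close> nearly exhausts the integral of \<open>h\<close>, while
  \<open>\<psi> \<ge> 0\<close> is simply dropped.\<close>

lemma improve_lower:
  assumes c: "c \<ge> 0" and ev: "eventually (\<lambda>x. c * g x \<le> h x) at_top" and eps: "\<epsilon> > 0"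
  shows "eventually (\<lambda>x. \<theta> * ((\<integral>x. h x \<partial>lborel) - \<epsilon> + c * (1 - \<epsilon>)) * g x \<le> h x) at_top"
proof -
  obtain x0 where x0: "\<And>x. x \<ge> x0 \<Longrightarrow> c * g x \<le> h x"
    using ev by (auto simp: eventually_at_top_linorder)
  have "eventually (\<lambda>a. J a > (\<integral>x. h x \<partial>lborel) - \<epsilon>) at_top"
    using eps by (intro order_tendstoD(1)[OF J_lim]) simp
  from eventually_happens'[OF trivial_limit_at_top_linorder eventually_conj[OF this
        eventually_conj[OF truncated_conv_ge[OF eps] eventually_ge_at_top[of x0]]]]
  obtain a where a: "a \<ge> x0" "J a > (\<integral>x. h x \<partial>lborel) - \<epsilon>" and
      tr: "eventually (\<lambda>x. (1 - \<epsilon>) * g x \<le> (\<integral>y. indicator {..x - a} y * g (x - y) \<partial>\<mu>)) at_top"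
    by blast
  have "eventually (\<lambda>x. near_end a x / g x > (\<integral>x. h x \<partial>lborel) - \<epsilon>) at_top"
    using a by (intro order_tendstoD(1)[OF near_end_asymp]) simp
  then show ?thesis using tr g_pos
  proof eventually_elim
    case (elim x)
    have "c * ((1 - \<epsilon>) * g x) \<le> (\<integral>y. c * (indicator {..x - a} y * g (x - y)) \<partial>\<mu>)"
      using elim c by (simp add: mult_left_mono)
    also have "\<dots> \<le> far a x"
      unfolding far_def
      by (intro integral_mono integrable_h_ind integrable_mult_right integrable_g_conv_ind)
         (use x0 a in \<open>auto simp: indicator_def\<close>)
    finally have far: "c * ((1 - \<epsilon>) * g x) \<le> far a x" .
    have "0 + \<theta> * (((\<integral>x. h x \<partial>lborel) - \<epsilon>) * g x + c * ((1 - \<epsilon>) * g x)) \<le> h x"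
      unfolding renewal_split[of x a] using elim far theta psi_nonneg
      by (intro add_mono mult_left_mono) (auto simp: pos_less_divide_eq)
    then show ?case by (simp add: algebra_simps)
  qed
qed

text \<open>The limits superior and inferior are encoded as \<open>u = Inf U\<close> and
  \<open>l = Sup L\<close> over constants that bound \<open>h / g\<close> eventually. Improvement
  yields \<open>u \<le> \<theta> * (I + u)\<close> and \<open>\<theta> * (I + l) \<le> l\<close>;
  \<open>h_bound\<close> keeps both \<open>u\<close> and \<open>l\<close> real.\<close>

theorem renewal_asymp:
  "((\<lambda>x. h x / g x) \<longlongrightarrow> \<theta> / (1 - \<theta>)\<^sup>2 * (\<integral>x. \<psi> x \<partial>lborel)) at_top"
proof -
  define I where "I = (\<integral>x. h x \<partial>lborel)"
  \<comment> \<open>The second factor \<open>1 - \<theta>\<close> in the denominator comes from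
    expressing \<open>I\<close> through the integral of \<open>\<psi>\<close>.\<close>
  have Ipsi: "\<theta> / (1 - \<theta>)\<^sup>2 * (\<integral>x. \<psi> x \<partial>lborel) = \<theta> * I / (1 - \<theta>)"
    unfolding integral_h[symmetric] I_def using theta by (simp add: power2_eq_square)
  obtain C where C: "C > 0" "eventually (\<lambda>x. h x \<le> C * g x) at_top" by (rule h_bound) blast
  define U where "U = {c. c \<ge> 0 \<and> eventually (\<lambda>x. h x \<le> c * g x) at_top}"
  define L where "L = {c. c \<ge> 0 \<and> eventually (\<lambda>x. c * g x \<le> h x) at_top}"
  have U: "C \<in> U" "bdd_below U" using C by (auto simp: U_def intro!: bdd_belowI[of _ 0])
  have L: "0 \<in> L" "bdd_above L"
  proof -
    show "bdd_above L"
    proof (rule bdd_aboveI[of _ C])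
      fix c assume "c \<in> L"
      then have "eventually (\<lambda>x. c * g x \<le> h x) at_top" by (simp add: L_def)
      from eventually_happens'[OF trivial_limit_at_top_linorder eventually_conj[OF g_pos eventually_conj[OF this C(2)]]]
      obtain x where "g x > 0" "c * g x \<le> C * g x" by (blast intro: order_trans)
      then show "c \<le> C" by simp
    qed
  qed (simp add: L_def)
  have I: "I \<ge> 0" unfolding I_def by (intro integral_nonneg_AE) auto
  define u where "u = Inf U"
  define l where "l = Sup L"
  have u0: "u \<ge> 0" unfolding u_def using U by (intro cInf_greatest) (auto simp: U_def)
  have l0: "l \<ge> 0" unfolding l_def using L by (intro cSup_upper)
  \<comment> \<open>A constant of \<open>U\<close> within \<open>\<epsilon>\<close> of
    \<open>u\<close> is improved to another element of \<open>U\<close>, which is at least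
    \<open>u\<close>; then \<open>\<epsilon>\<close> tends to zero from the right.\<close>
  have "u \<le> \<theta> * (I + u)"
  proof (rule tendsto_lowerbound)
    show "((\<lambda>\<epsilon>. \<epsilon> + \<theta> * (I + \<epsilon> + (u + \<epsilon>) * (1 + \<epsilon>))) \<longlongrightarrow> \<theta> * (I + u)) (at_right 0)"
      by (auto intro!: tendsto_eq_intros)
    show "eventually (\<lambda>\<epsilon>. u \<le> \<epsilon> + \<theta> * (I + \<epsilon> + (u + \<epsilon>) * (1 + \<epsilon>))) (at_right 0)"
      using eventually_at_right_less[of 0]
    proof eventually_elim
      case (elim \<epsilon>)
      have "\<exists>c\<in>U. c < u + \<epsilon>" using U elim unfolding u_def by (intro cInf_lessD) auto
      then obtain c where c: "c \<in> U" "c < u + \<epsilon>" by blast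
      have "\<epsilon> + \<theta> * (I + \<epsilon> + c * (1 + \<epsilon>)) \<in> U"
        using improve_upper[of c \<epsilon>] c elim theta I by (auto simp: U_def I_def)
      then have "u \<le> \<epsilon> + \<theta> * (I + \<epsilon> + c * (1 + \<epsilon>))"
        unfolding u_def using U by (intro cInf_lower)
      also have "\<dots> \<le> \<epsilon> + \<theta> * (I + \<epsilon> + (u + \<epsilon>) * (1 + \<epsilon>))"
        using c elim theta by (intro add_left_mono mult_left_mono mult_right_mono) auto
      finally show ?case .
    qed
  qed simp
  moreover have "\<theta> * (I + l) \<le> l"
  proof (rule tendsto_upperbound)
    show "((\<lambda>\<epsilon>. \<theta> * (I - \<epsilon> + (l - \<epsilon>) * (1 - \<epsilon>))) \<longlongrightarrow> \<theta> * (I + l)) (at_right 0)"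
      by (auto intro!: tendsto_eq_intros)
    \<comment> \<open>Keeps \<open>1 - \<epsilon>\<close> nonnegative, so that
      \<open>l - \<epsilon>\<close> may be replaced by the larger \<open>c\<close>.\<close>
    have "eventually (\<lambda>\<epsilon>::real. \<epsilon> < 1) (at_right 0)"
      by (rule eventually_at_right_less[THEN eventually_rev_mp]) (auto simp: eventually_at_right_field intro!: exI[of _ 1])
    then show "eventually (\<lambda>\<epsilon>. \<theta> * (I - \<epsilon> + (l - \<epsilon>) * (1 - \<epsilon>)) \<le> l) (at_right 0)"
      using eventually_at_right_less[of 0]
    proof eventually_elim
      case (elim \<epsilon>)
      have "\<exists>c\<in>L. l - \<epsilon> < c" using L elim unfolding l_def by (intro less_cSupD) auto
      then obtain c where c: "c \<in> L" "l - \<epsilon> < c" by blast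
      \<comment> \<open>\<open>L\<close> contains nonnegative constants only; a negative value is
        below \<open>l \<ge> 0\<close> anyway.\<close>
      have "\<theta> * (I - \<epsilon> + c * (1 - \<epsilon>)) \<le> l"
      proof (cases "\<theta> * (I - \<epsilon> + c * (1 - \<epsilon>)) \<ge> 0")
        case True
        then have "\<theta> * (I - \<epsilon> + c * (1 - \<epsilon>)) \<in> L"
          using improve_lower[of c \<epsilon>] c elim by (auto simp: L_def I_def)
        then show ?thesis unfolding l_def using L by (intro cSup_upper)
      qed (use l0 in auto)
      moreover have "\<theta> * (I - \<epsilon> + (l - \<epsilon>) * (1 - \<epsilon>)) \<le> \<theta> * (I - \<epsilon> + c * (1 - \<epsilon>))"
        using c elim theta by (intro add_left_mono mult_left_mono mult_right_mono) auto
      ultimately show ?case by simp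
    qed
  qed simp
  \<comment> \<open>Below every \<open>b\<close> larger than this value there is now a constant of
    \<open>U\<close>, and above every smaller \<open>b\<close> one of \<open>L\<close>, which gives
    convergence.\<close>
  ultimately have ul: "u \<le> \<theta> * I / (1 - \<theta>)" "\<theta> * I / (1 - \<theta>) \<le> l"
    using theta by (auto simp: field_simps)
  show ?thesis
    unfolding Ipsi
  proof (rule order_tendstoI)
    fix b assume "b < \<theta> * I / (1 - \<theta>)"
    then have "\<exists>c\<in>L. b < c" using L ul unfolding l_def by (intro less_cSupD) (auto simp: l_def)
    then obtain c where c: "c \<in> L" "b < c" by blast
    then have "eventually (\<lambda>x. c * g x \<le> h x) at_top" by (simp add: L_def)
    then show "eventually (\<lambda>x. b < h x / g x) at_top" using g_pos
      by eventually_elim (use c in \<open>auto simp: pos_less_divide_eq intro: less_le_trans[OF mult_strict_right_mono]\<close>)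
  next
    fix b assume "b > \<theta> * I / (1 - \<theta>)"
    then have "\<exists>c\<in>U. c < b" using U ul unfolding u_def by (intro cInf_lessD) (auto simp: u_def)
    then obtain c where c: "c \<in> U" "c < b" by blast
    then have "eventually (\<lambda>x. h x \<le> c * g x) at_top" by (simp add: U_def)
    then show "eventually (\<lambda>x. h x / g x < b) at_top" using g_pos
      by eventually_elim (use c in \<open>auto simp: pos_divide_less_eq intro: le_less_trans[OF _ mult_strict_right_mono]\<close>)
  qed
qed

end

section \<open>The maximum equation\<close>

lemma nn_integral_exp_between:
  fixes \<kappa> U V :: real
  assumes "\<kappa> > 0" "U \<ge> 0" "V \<ge> 0"
  shows "(\<integral>\<^sup>+x. ennreal (indicator {x. U \<le> exp x \<and> exp x < V} x * exp (\<kappa> * x)) \<partial>lborel) =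
    ennreal ((max U V powr \<kappa> - U powr \<kappa>) / \<kappa>)"
proof (cases "U < V")
  case False
  \<comment> \<open>The maximum in the formula makes the right-hand side vanish on this empty
    range.\<close>
  then have "{x. U \<le> exp x \<and> exp x < V} = {}" by auto
  with False show ?thesis by simp
next
  case True
  then have V: "V > 0" using assms by simp
  have has: "has_bochner_integral lborel (\<lambda>w. indicator {..<ln a} w * exp (\<kappa> * w)) (a powr \<kappa> / \<kappa>)" if "a > 0" for a
    using has_bochner_integral_exp_lessThan[OF assms(1), of "ln a"] that by (simp add: powr_def)
  have iff: "x < ln a \<longleftrightarrow> exp x < a" if "a > 0" for a x :: real
    by (metis exp_less_cancel_iff exp_ln that)
  have "has_bochner_integral lborel (\<lambda>x. indicator {x. U \<le> exp x \<and> exp x < V} x * exp (\<kappa> * x))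
      (V powr \<kappa> / \<kappa> - U powr \<kappa> / \<kappa>)"
  \<comment> \<open>Since \<open>ln 0 = 0\<close>, the ray \<open>{..<ln U}\<close> would be wrong
    at \<open>U = 0\<close>; there the lower constraint is vacuous and
    \<open>0 powr \<kappa> = 0\<close>.\<close>
  proof (cases "U = 0")
    case True
    have "{x. U \<le> exp x \<and> exp x < V} = {..<ln V}"
      using True by (auto simp: iff[OF V])
    then show ?thesis using has[OF V] True by simp
  next
    case False
    then have U: "U > 0" using assms by simp
    have "has_bochner_integral lborel (\<lambda>w. indicator {..<ln V} w * exp (\<kappa> * w) - indicator {..<ln U} w * exp (\<kappa> * w))
        (V powr \<kappa> / \<kappa> - U powr \<kappa> / \<kappa>)"
      by (intro has_bochner_integral_diff has U V)
    moreover have "indicator {..<ln V} w * exp (\<kappa> * w) - indicator {..<ln U} w * exp (\<kappa> * w) =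
        indicator {x. U \<le> exp x \<and> exp x < V} w * exp (\<kappa> * w)" for w
      using \<open>U < V\<close> by (auto simp: indicator_def iff U V)
    ultimately show ?thesis by simp
  qed
  then have "(\<integral>\<^sup>+x. ennreal (indicator {x. U \<le> exp x \<and> exp x < V} x * exp (\<kappa> * x)) \<partial>lborel) =
      ennreal (V powr \<kappa> / \<kappa> - U powr \<kappa> / \<kappa>)"
    by (subst nn_integral_eq_integral) (auto simp: has_bochner_integral_iff)
  then show ?thesis using True by (simp add: diff_divide_distrib max_def)
qed

text \<open>Events of \<open>A\<close> are events of the pair \<open>(A, B)\<close>, namely
  preimages of cylinders, and independence passes to subfamilies. Stability under intersection then
  carries it to the generated sigma-algebras.\<close>

lemma (in prob_space) indep_rvs_fst:
  fixes A B X :: "'a \<Rightarrow> real"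
  assumes [measurable]: "A \<in> borel_measurable M"
    and ind: "indep_rvs M borel X (borel \<Otimes>\<^sub>M borel) (\<lambda>\<omega>. (A \<omega>, B \<omega>))"
  shows "indep_var borel X borel A"
proof -
  have X [measurable]: "random_variable borel X" using ind by (simp add: indep_rvs_def)
  have indep_mono: "indep_set P R" if "indep_set P Q" "R \<subseteq> Q" for P Q R
    using that unfolding indep_sets2_eq by blast
  have stable: "Int_stable {Y -` C \<inter> space M |C. C \<in> sets borel}" for Y :: "'a \<Rightarrow> real"
    unfolding Int_stable_def
  proof safe
    fix C D :: "real set" assume "C \<in> sets borel" "D \<in> sets borel"
    then show "\<exists>E. Y -` C \<inter> space M \<inter> (Y -` D \<inter> space M) = Y -` E \<inter> space M \<and> E \<in> sets borel"
      by (intro exI[of _ "C \<inter> D"]) auto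
  qed
  have "indep_set {X -` C \<inter> space M |C. C \<in> sets borel}
      {(\<lambda>\<omega>. (A \<omega>, B \<omega>)) -` C \<inter> space M |C. C \<in> sets (borel \<Otimes>\<^sub>M borel)}"
    using ind by (simp add: indep_rvs_def)
  moreover have "{A -` C \<inter> space M |C. C \<in> sets borel} \<subseteq>
      {(\<lambda>\<omega>. (A \<omega>, B \<omega>)) -` C \<inter> space M |C. C \<in> sets (borel \<Otimes>\<^sub>M borel)}"
  proof safe
    fix C :: "real set" assume "C \<in> sets borel"
    then show "\<exists>D. A -` C \<inter> space M = (\<lambda>\<omega>. (A \<omega>, B \<omega>)) -` D \<inter> space M \<and> D \<in> sets (borel \<Otimes>\<^sub>M borel)"
      by (intro exI[of _ "C \<times> UNIV"]) auto
  qed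
  ultimately have "indep_set {X -` C \<inter> space M |C. C \<in> sets borel} {A -` C \<inter> space M |C. C \<in> sets borel}"
    by (rule indep_mono)
  then show ?thesis
    unfolding indep_var_eq using X by (auto intro!: indep_set_sigma_sets stable)
qed

text \<open>Independence turns the joint law into a product, and \<open>X\<close> is integrated
  first. As \<open>t > 0\<close>, the event requires \<open>A > 0\<close> almost surely; the
  indicator removes the default value of \<open>t / 0\<close>.\<close>

lemma (in prob_space) prob_product_gt:
  fixes X A :: "'a \<Rightarrow> real"
  assumes ind: "indep_var borel X borel A" and A: "AE \<omega> in M. A \<omega> \<ge> 0" and t: "t > 0"
  shows "prob {\<omega> \<in> space M. A \<omega> * X \<omega> > t} =
    (\<integral>\<omega>. indicator {0<..} (A \<omega>) * prob {\<omega>' \<in> space M. X \<omega>' > t / A \<omega>} \<partial>M)"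
proof -
  have X [measurable]: "random_variable borel X" and A' [measurable]: "random_variable borel A"
    using ind by (auto dest: indep_var_rv1 indep_var_rv2)
  interpret PX: prob_space "distr M borel X" by (rule prob_space_distr) fact
  interpret PA: prob_space "distr M borel A" by (rule prob_space_distr) fact
  interpret P: pair_sigma_finite "distr M borel X" "distr M borel A" ..
  let ?S = "\<lambda>x a. indicator {p. snd p > 0 \<and> snd p * fst p > t} (x, a) :: ennreal"
  have "ennreal (prob {\<omega> \<in> space M. A \<omega> * X \<omega> > t}) = ennreal (prob {\<omega> \<in> space M. A \<omega> > 0 \<and> A \<omega> * X \<omega> > t})"
    using A t by (intro arg_cong[where f = ennreal] measure_eq_AE) (auto elim!: eventually_mono simp: le_less)
  also have "\<dots> = (\<integral>\<^sup>+\<omega>. indicator {\<omega> \<in> space M. A \<omega> > 0 \<and> A \<omega> * X \<omega> > t} \<omega> \<partial>M)"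
    by (subst nn_integral_indicator) (auto simp: emeasure_eq_measure)
  also have "\<dots> = (\<integral>\<^sup>+\<omega>. ?S (X \<omega>) (A \<omega>) \<partial>M)"
    by (intro nn_integral_cong) (simp add: indicator_def)
  also have "\<dots> = (\<integral>\<^sup>+p. case_prod ?S p \<partial>distr M (borel \<Otimes>\<^sub>M borel) (\<lambda>\<omega>. (X \<omega>, A \<omega>)))"
    by (subst nn_integral_distr) auto
  also have "\<dots> = (\<integral>\<^sup>+p. case_prod ?S p \<partial>(distr M borel X \<Otimes>\<^sub>M distr M borel A))"
    using ind by (simp add: indep_var_distribution_eq)
  also have "\<dots> = (\<integral>\<^sup>+a. (\<integral>\<^sup>+x. ?S x a \<partial>distr M borel X) \<partial>distr M borel A)"
    by (subst P.nn_integral_snd[symmetric]) auto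
  also have "\<dots> = (\<integral>\<^sup>+\<omega>. (\<integral>\<^sup>+x. ?S x (A \<omega>) \<partial>distr M borel X) \<partial>M)"
    by (subst nn_integral_distr) auto
  also have "\<dots> = (\<integral>\<^sup>+\<omega>. ennreal (indicator {0<..} (A \<omega>) * prob {\<omega>' \<in> space M. X \<omega>' > t / A \<omega>}) \<partial>M)"
  proof (rule nn_integral_cong)
    fix \<omega>
    have "(\<integral>\<^sup>+x. ?S x (A \<omega>) \<partial>distr M borel X) = (\<integral>\<^sup>+\<omega>'. ?S (X \<omega>') (A \<omega>) \<partial>M)"
      by (subst nn_integral_distr) auto
    also have "\<dots> = (\<integral>\<^sup>+\<omega>'. indicator {0<..} (A \<omega>) * indicator {\<omega>' \<in> space M. X \<omega>' > t / A \<omega>} \<omega>' \<partial>M)"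
      by (intro nn_integral_cong) (auto simp: indicator_def field_simps)
    also have "\<dots> = ennreal (indicator {0<..} (A \<omega>) * prob {\<omega>' \<in> space M. X \<omega>' > t / A \<omega>})"
      by (cases "A \<omega> > 0") (simp_all add: emeasure_eq_measure)
    finally show "(\<integral>\<^sup>+x. ?S x (A \<omega>) \<partial>distr M borel X) =
        ennreal (indicator {0<..} (A \<omega>) * prob {\<omega>' \<in> space M. X \<omega>' > t / A \<omega>})" .
  qed
  also have "\<dots> = ennreal (\<integral>\<omega>. indicator {0<..} (A \<omega>) * prob {\<omega>' \<in> space M. X \<omega>' > t / A \<omega>} \<partial>M)"
    by (intro nn_integral_eq_integral integrable_const_bound[where B = 1] AE_I2) (auto simp: indicator_def)
  finally show ?thesis
    by (subst (asm) ennreal_inj) (auto intro!: integral_nonneg_AE)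
qed

section \<open>The tail of \<open>X\<close> as a solution of the renewal equation\<close>

theorem theorem4:
  fixes M :: "'a measure" and A B X :: "'a \<Rightarrow> real" and \<kappa> \<theta> \<nu> :: real
    and F g :: "real \<Rightarrow> real"
  assumes "prob_space M"
    and "A \<in> borel_measurable M" and "B \<in> borel_measurable M"
    and "AE \<omega> in M. A \<omega> \<ge> 0"
    and "\<not> (AE \<omega> in M. A \<omega> = 1)"
    and "\<kappa> > 0"
    and "integrable M (\<lambda>\<omega>. A \<omega> powr \<kappa>)"
    and "\<theta> = (\<integral>\<omega>. A \<omega> powr \<kappa> \<partial>M)" and "0 < \<theta>" and "\<theta> < 1"
    and "F = tilted_df M A \<kappa>"
    and "locally_subexponential F"
    and "\<exists>K x0. \<forall>x\<ge>x0. (SUP y\<in>{x<..}. local_mass 1 F y) \<le> K * local_mass 1 F x"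
    and "nonarithmetic (cond_log_law M A)"
    and "\<nu> > \<kappa>" and "integrable M (\<lambda>\<omega>. \<bar>B \<omega>\<bar> powr \<nu>)"
    and "max_equation_solution M A B X"
    and "g = (\<lambda>x. F (x + 1) - F x)"
  shows "((\<lambda>x. inverse (g (ln x)) * x powr \<kappa> * measure M {\<omega> \<in> space M. X \<omega> > x})
     \<longlongrightarrow> \<theta> / ((1 - \<theta>)\<^sup>2 * \<kappa>) *
        (\<integral>\<omega>. max (A \<omega> * max (X \<omega>) 0) (max (B \<omega>) 0) powr \<kappa>
              - (A \<omega> * max (X \<omega>) 0) powr \<kappa> \<partial>M)) at_top"
proof -
  interpret prob_space M by fact
  note [measurable] = assms(2,3)
  note A_nn = assms(4) and kappa = assms(6) and theta = assms(9,10)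
  have ind: "indep_var borel X borel A"
    and fixpoint: "distr M borel X = distr M borel (\<lambda>\<omega>. max (A \<omega> * X \<omega>) (B \<omega>))"
    using assms(17) by (auto simp: max_equation_solution_def intro: indep_rvs_fst)
  have [measurable]: "X \<in> borel_measurable M" using ind by (rule indep_var_rv1)

  \<comment> \<open>The default \<open>ln 0 = 0\<close> carries no mass, because the density
    vanishes where \<open>A = 0\<close>; for the same reason \<open>ln\<close> and
    \<open>ext_ln\<close> give the same distribution function below.\<close>
  define D where "D = density M (\<lambda>\<omega>. ennreal (A \<omega> powr \<kappa> / \<theta>))"
  define \<mu> where "\<mu> = distr D borel (\<lambda>\<omega>. ln (A \<omega>))"
  have [measurable_cong, simp]: "sets D = sets M" by (simp add: D_def)
  have int_mu: "(\<integral>y. f y \<partial>\<mu>) = (\<integral>\<omega>. A \<omega> powr \<kappa> / \<theta> * f (ln (A \<omega>)) \<partial>M)"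
    if [measurable]: "f \<in> borel_measurable borel" for f :: "real \<Rightarrow> real"
    using theta unfolding \<mu>_def by (subst integral_distr) (auto simp: D_def integral_density)
  have theta_int_mu: "\<theta> * (\<integral>y. f y \<partial>\<mu>) = (\<integral>\<omega>. A \<omega> powr \<kappa> * f (ln (A \<omega>)) \<partial>M)"
    if "f \<in> borel_measurable borel" for f :: "real \<Rightarrow> real"
    using theta by (simp add: int_mu[OF that])
  have "emeasure D (space D) = 1"
  proof -
    have "emeasure D (space D) = (\<integral>\<^sup>+\<omega>. ennreal (A \<omega> powr \<kappa> / \<theta>) \<partial>M)"
      by (simp add: D_def emeasure_density cong: nn_integral_cong)
    also have "\<dots> = ennreal (\<integral>\<omega>. A \<omega> powr \<kappa> / \<theta> \<partial>M)"
      using assms(7) theta by (intro nn_integral_eq_integral) auto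
    also have "\<dots> = 1" using theta by (simp add: assms(8)[symmetric])
    finally show ?thesis .
  qed
  then interpret D: prob_space D by (rule prob_spaceI)
  have mu_dist: "real_distribution \<mu>"
    unfolding \<mu>_def by (rule D.real_distribution_distr) (simp add: D_def)
  interpret mu: real_distribution \<mu> by (rule mu_dist)
  have [measurable]: "ext_ln \<in> borel_measurable borel"
    unfolding ext_ln_def[abs_def] by measurable
  have F: "cdf \<mu> = F"
  proof
    fix x
    have "cdf \<mu> x = (\<integral>y. indicator {..x} y \<partial>\<mu>)" by (simp add: cdf_def)
    also have "\<dots> = (\<integral>\<omega>. A \<omega> powr \<kappa> / \<theta> * indicator {..x} (ln (A \<omega>)) \<partial>M)"
      by (rule int_mu) simp
    also have "\<dots> = (\<integral>\<omega>. inverse \<theta> * (indicator {\<omega>. ext_ln (A \<omega>) \<le> ereal x} \<omega> * A \<omega> powr \<kappa>) \<partial>M)"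
    proof (rule integral_cong_AE)
      show "AE \<omega> in M. A \<omega> powr \<kappa> / \<theta> * indicator {..x} (ln (A \<omega>)) =
          inverse \<theta> * (indicator {\<omega>. ext_ln (A \<omega>) \<le> ereal x} \<omega> * A \<omega> powr \<kappa>)"
        using A_nn by eventually_elim (auto simp: ext_ln_def indicator_def divide_inverse)
    qed measurable
    also have "\<dots> = F x" by (simp add: assms(11) tilted_df_def assms(8))
    finally show "cdf \<mu> x = F x" .
  qed

  define G where "G x = prob {\<omega> \<in> space M. X \<omega> > exp x}" for x
  define \<psi> where "\<psi> x = exp (\<kappa> * x) * prob {\<omega> \<in> space M. A \<omega> * X \<omega> \<le> exp x \<and> exp x < B \<omega>}" for x
  have G_anti: "antimono G"
    unfolding G_def antimono_def by (auto intro!: finite_measure_mono elim: le_less_trans[rotated])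
  then have "mono (\<lambda>x. - G x)" by (simp add: mono_def antimono_def)
  then have "(\<lambda>x. - G x) \<in> borel_measurable borel" by (rule borel_measurable_mono)
  then have [measurable]: "G \<in> borel_measurable borel" by simp

  have G_lim: "(G \<longlongrightarrow> 0) at_top"
  proof -
    interpret PX: real_distribution "distr M borel X" by simp
    have "G = (\<lambda>x. 1 - cdf (distr M borel X) (exp x))"
    proof
      fix x
      have "{\<omega> \<in> space M. X \<omega> > exp x} = space M - X -` {..exp x} \<inter> space M" by auto
      then show "G x = 1 - cdf (distr M borel X) (exp x)"
        unfolding G_def cdf_def by (simp add: measure_distr prob_compl)
    qed
    moreover have "((\<lambda>x::real. cdf (distr M borel X) (exp x)) \<longlongrightarrow> 1) at_top"
      by (rule filterlim_compose[OF PX.cdf_lim_at_top_prob exp_at_top])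
    ultimately show ?thesis
      using tendsto_diff[OF tendsto_const[of 1], of "\<lambda>x. cdf (distr M borel X) (exp x)" 1 at_top]
      by simp
  qed

  \<comment> \<open>The event that the maximum exceeds \<open>exp x\<close> is split by whether
    \<open>A X\<close> already does so; otherwise \<open>B\<close> alone is responsible.\<close>
  have G_eq: "G x = prob {\<omega> \<in> space M. A \<omega> * X \<omega> > exp x} +
      prob {\<omega> \<in> space M. A \<omega> * X \<omega> \<le> exp x \<and> exp x < B \<omega>}" for x
  proof -
    have "G x = measure (distr M borel X) {exp x<..}"
      by (auto simp: G_def measure_distr intro!: arg_cong[where f = prob])
    also have "\<dots> = prob ({\<omega> \<in> space M. A \<omega> * X \<omega> > exp x} \<union> {\<omega> \<in> space M. A \<omega> * X \<omega> \<le> exp x \<and> exp x < B \<omega>})"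
      unfolding fixpoint by (auto simp: measure_distr less_max_iff_disj intro!: arg_cong[where f = prob])
    also have "\<dots> = prob {\<omega> \<in> space M. A \<omega> * X \<omega> > exp x} + prob {\<omega> \<in> space M. A \<omega> * X \<omega> \<le> exp x \<and> exp x < B \<omega>}"
      by (rule finite_measure_Union) auto
    finally show ?thesis .
  qed

  have renewal: "exp (\<kappa> * x) * G x = \<psi> x + \<theta> * (\<integral>y. exp (\<kappa> * (x - y)) * G (x - y) \<partial>\<mu>)" for x
  proof -
    have "\<theta> * (\<integral>y. exp (\<kappa> * (x - y)) * G (x - y) \<partial>\<mu>) =
        (\<integral>\<omega>. A \<omega> powr \<kappa> * (exp (\<kappa> * (x - ln (A \<omega>))) * G (x - ln (A \<omega>))) \<partial>M)"
      by (rule theta_int_mu) measurable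
    \<comment> \<open>For \<open>A > 0\<close> the tilt \<open>A powr \<kappa>\<close> cancels
      \<open>exp (- \<kappa> * ln A)\<close>, and \<open>exp (x - ln A) = exp x / A\<close>; for
      \<open>A = 0\<close> both sides vanish.\<close>
    also have "\<dots> = (\<integral>\<omega>. exp (\<kappa> * x) * (indicator {0<..} (A \<omega>) * prob {\<omega>' \<in> space M. X \<omega>' > exp x / A \<omega>}) \<partial>M)"
    proof (rule integral_cong_AE)
      show "AE \<omega> in M. A \<omega> powr \<kappa> * (exp (\<kappa> * (x - ln (A \<omega>))) * G (x - ln (A \<omega>))) =
          exp (\<kappa> * x) * (indicator {0<..} (A \<omega>) * prob {\<omega>' \<in> space M. X \<omega>' > exp x / A \<omega>})"
        using A_nn
      proof eventually_elim
        case (elim \<omega>)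
        show ?case
        proof (cases "A \<omega> = 0")
          case False
          then have "A \<omega> > 0" using elim by simp
          then show ?thesis by (simp add: G_def powr_def exp_diff right_diff_distrib)
        qed simp
      qed
    qed measurable
    also have "\<dots> = exp (\<kappa> * x) * prob {\<omega> \<in> space M. A \<omega> * X \<omega> > exp x}"
      by (subst prob_product_gt[OF ind A_nn]) auto
    finally show ?thesis by (simp add: G_eq \<psi>_def distrib_left)
  qed

  have psi_meas [measurable]: "\<psi> \<in> borel_measurable borel"
    unfolding \<psi>_def by measurable

  \<comment> \<open>Markov's inequality for the moment of order \<open>\<nu>\<close> of
    \<open>B\<close>; the excess of \<open>\<nu>\<close> over \<open>\<kappa>\<close> is the rate of
    decay.\<close>
  have psi_bound: "\<psi> x \<le> (\<integral>\<omega>. \<bar>B \<omega>\<bar> powr \<nu> \<partial>M) * exp (- (\<nu> - \<kappa>) * x)" for x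
  proof -
    have "exp (\<nu> * x) * prob {\<omega> \<in> space M. A \<omega> * X \<omega> \<le> exp x \<and> exp x < B \<omega>} =
        (\<integral>\<omega>. exp (\<nu> * x) * indicator {\<omega> \<in> space M. A \<omega> * X \<omega> \<le> exp x \<and> exp x < B \<omega>} \<omega> \<partial>M)"
      by simp
    also have "\<dots> \<le> (\<integral>\<omega>. \<bar>B \<omega>\<bar> powr \<nu> \<partial>M)"
    proof (rule integral_mono)
      fix \<omega>
      have "exp (\<nu> * x) \<le> \<bar>B \<omega>\<bar> powr \<nu>" if "exp x < B \<omega>"
      proof -
        have "exp (\<nu> * x) = exp x powr \<nu>" by (simp add: powr_def)
        also have "\<dots> \<le> \<bar>B \<omega>\<bar> powr \<nu>" using that kappa assms(15) by (intro powr_mono2) auto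
        finally show ?thesis .
      qed
      then show "exp (\<nu> * x) * indicator {\<omega> \<in> space M. A \<omega> * X \<omega> \<le> exp x \<and> exp x < B \<omega>} \<omega> \<le> \<bar>B \<omega>\<bar> powr \<nu>"
        by (auto simp: indicator_def)
    qed (use assms(16) in \<open>auto intro!: integrable_mult_right simp: emeasure_eq_measure\<close>)
    finally have *: "exp (\<nu> * x) * prob {\<omega> \<in> space M. A \<omega> * X \<omega> \<le> exp x \<and> exp x < B \<omega>} \<le> (\<integral>\<omega>. \<bar>B \<omega>\<bar> powr \<nu> \<partial>M)" .
    have "\<psi> x = exp (\<nu> * x) * prob {\<omega> \<in> space M. A \<omega> * X \<omega> \<le> exp x \<and> exp x < B \<omega>} * exp (- (\<nu> - \<kappa>) * x)"
      unfolding \<psi>_def by (simp add: algebra_simps flip: exp_add)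
    also have "\<dots> \<le> (\<integral>\<omega>. \<bar>B \<omega>\<bar> powr \<nu> \<partial>M) * exp (- (\<nu> - \<kappa>) * x)"
      using * by (intro mult_right_mono) auto
    finally show ?thesis .
  qed

  have exp_mu: "integrable \<mu> (\<lambda>y. exp (- \<kappa> * y))" "\<theta> * (\<integral>y. exp (- \<kappa> * y) \<partial>\<mu>) \<le> 1"
  proof -
    \<comment> \<open>The product is one where \<open>A > 0\<close> and zero where
      \<open>A = 0\<close>.\<close>
    have le: "AE \<omega> in M. A \<omega> powr \<kappa> * exp (- \<kappa> * ln (A \<omega>)) \<le> 1"
      using A_nn by eventually_elim (auto simp: powr_def exp_minus)
    have int: "integrable M (\<lambda>\<omega>. A \<omega> powr \<kappa> * exp (- \<kappa> * ln (A \<omega>)))"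
      by (rule integrable_const_bound[where B = 1]) (use le in \<open>auto elim: eventually_mono\<close>)
    then have "integrable M (\<lambda>\<omega>. A \<omega> powr \<kappa> / \<theta> * exp (- \<kappa> * ln (A \<omega>)))" by simp
    then show "integrable \<mu> (\<lambda>y. exp (- \<kappa> * y))"
      using theta unfolding \<mu>_def by (subst integrable_distr_eq) (auto simp: D_def integrable_density)
    have "\<theta> * (\<integral>y. exp (- \<kappa> * y) \<partial>\<mu>) = (\<integral>\<omega>. A \<omega> powr \<kappa> * exp (- \<kappa> * ln (A \<omega>)) \<partial>M)"
      by (rule theta_int_mu) measurable
    also have "\<dots> \<le> (\<integral>\<omega>. 1 \<partial>M)" by (rule integral_mono_AE[OF int _ le]) simp
    finally show "\<theta> * (\<integral>y. exp (- \<kappa> * y) \<partial>\<mu>) \<le> 1" using prob_space by simp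
  qed

  interpret R: locally_subexponential_renewal \<mu> \<kappa> \<theta> "\<nu> - \<kappa>" "\<integral>\<omega>. \<bar>B \<omega>\<bar> powr \<nu> \<partial>M" G \<psi>
  proof
    show "locally_subexponential (cdf \<mu>)" using assms(12) by (simp add: F)
    show "\<exists>K x0. \<forall>x\<ge>x0. (SUP y\<in>{x<..}. local_mass 1 (cdf \<mu>) y) \<le> K * local_mass 1 (cdf \<mu>) x"
      using assms(13) by (simp add: F)
    show "0 \<le> G x" "G x \<le> 1" "0 \<le> \<psi> x" for x by (simp_all add: G_def \<psi>_def)
    show "0 < \<nu> - \<kappa>" using assms(15) by simp
  qed (rule kappa theta G_anti G_lim psi_meas psi_bound exp_mu renewal)+

  have integral_psi: "(\<integral>x. \<psi> x \<partial>lborel) =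
      (\<integral>\<omega>. max (A \<omega> * max (X \<omega>) 0) (max (B \<omega>) 0) powr \<kappa> - (A \<omega> * max (X \<omega>) 0) powr \<kappa> \<partial>M) / \<kappa>"
  proof -
    interpret P: pair_sigma_finite M lborel ..
    let ?d = "\<lambda>\<omega>. max (A \<omega> * max (X \<omega>) 0) (max (B \<omega>) 0) powr \<kappa> - (A \<omega> * max (X \<omega>) 0) powr \<kappa>"
    have d_nn: "AE \<omega> in M. 0 \<le> ?d \<omega> / \<kappa>"
      using A_nn by eventually_elim (use kappa in \<open>auto intro!: divide_nonneg_pos powr_mono2\<close>)
    have "(\<integral>\<^sup>+x. ennreal (\<psi> x) \<partial>lborel) = (\<integral>\<^sup>+x. (\<integral>\<^sup>+\<omega>. ennreal (exp (\<kappa> * x)) *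
        indicator {\<omega> \<in> space M. A \<omega> * X \<omega> \<le> exp x \<and> exp x < B \<omega>} \<omega> \<partial>M) \<partial>lborel)"
      by (intro nn_integral_cong) (simp add: \<psi>_def nn_integral_cmult emeasure_eq_measure ennreal_mult)
    also have "\<dots> = (\<integral>\<^sup>+x. (\<integral>\<^sup>+\<omega>. ennreal (indicator {x. A \<omega> * X \<omega> \<le> exp x \<and> exp x < B \<omega>} x * exp (\<kappa> * x)) \<partial>M) \<partial>lborel)"
      by (intro nn_integral_cong) (auto simp: indicator_def)
    also have "\<dots> = (\<integral>\<^sup>+\<omega>. (\<integral>\<^sup>+x. ennreal (indicator {x. A \<omega> * X \<omega> \<le> exp x \<and> exp x < B \<omega>} x * exp (\<kappa> * x)) \<partial>lborel) \<partial>M)"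
      by (rule P.Fubini') (simp add: indicator_def split_beta')
    also have "\<dots> = (\<integral>\<^sup>+\<omega>. ennreal (?d \<omega> / \<kappa>) \<partial>M)"
      using A_nn
    proof (intro nn_integral_cong_AE, eventually_elim)
      case (elim \<omega>)
      \<comment> \<open>As \<open>exp x > 0\<close>, passing to the positive parts of
        \<open>X\<close> and \<open>B\<close> leaves the range unchanged and gives the nonnegative
        endpoints required by \<open>nn_integral_exp_between\<close>.\<close>
      have "{x. A \<omega> * X \<omega> \<le> exp x \<and> exp x < B \<omega>} = {x. A \<omega> * max (X \<omega>) 0 \<le> exp x \<and> exp x < max (B \<omega>) 0}"
        using elim by (auto simp: max_def not_le intro: order_trans[OF mult_nonneg_nonpos] dest: less_trans[OF exp_gt_zero])
      then show ?case using elim kappa by (simp only: nn_integral_exp_between mult_nonneg_nonneg max.cobounded2)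
    qed
    finally have "(\<integral>x. \<psi> x \<partial>lborel) = (\<integral>\<omega>. ?d \<omega> / \<kappa> \<partial>M)"
      \<comment> \<open>For nonnegative measurable functions the Bochner integral is determined by
        the nonnegative integral, so equality transfers directly.\<close>
      using d_nn by (subst (1 2) integral_eq_nn_integral) (auto simp: R.psi_nonneg)
    then show ?thesis by simp
  qed

  have "((\<lambda>x. R.h (ln x) / R.g (ln x)) \<longlongrightarrow> \<theta> / (1 - \<theta>)\<^sup>2 * (\<integral>x. \<psi> x \<partial>lborel)) at_top"
    by (rule filterlim_compose[OF R.renewal_asymp ln_at_top])
  moreover have "eventually (\<lambda>x. R.h (ln x) / R.g (ln x) =
      inverse (g (ln x)) * x powr \<kappa> * measure M {\<omega> \<in> space M. X \<omega> > x}) at_top"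
    using eventually_gt_at_top[of 0]
    by eventually_elim
      (simp add: R.h_def R.g_def G_def F assms(18) local_mass_def powr_def divide_inverse mult_ac)
  ultimately have "((\<lambda>x. inverse (g (ln x)) * x powr \<kappa> * measure M {\<omega> \<in> space M. X \<omega> > x})
      \<longlongrightarrow> \<theta> / (1 - \<theta>)\<^sup>2 * (\<integral>x. \<psi> x \<partial>lborel)) at_top"
    by (rule Lim_transform_eventually)
  then show ?thesis by (simp add: integral_psi)
qed

end
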